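(* For positive integers $n$ and $k\ge 2$, there exists a Karp reduction from $(0,1)$-$\mathrm{CVP}_2$ on lattices of rank $n$ to minimum-weight-$k$-Clique on undirected graphs with $N=k\cdot 2^{\lceil n/k\rceil}$ vertices. Furthermore, if the absolute value of every coordinate of all basis vectors and of the target vector is at most $2^\eta$, then the reduction takes only $O(m\cdot\eta^2\cdot(k\cdot 2^{\lceil n/k\rceil})^2)$ time and space, and the edge weights of the produced graph are bounded by $O(m\cdot 2^{2\eta})$.
   Context: $(0,1)$-$\mathrm{CVP}_2$: given a basis $\mathbf{B}\in\mathbb{Z}^{m\times n}$ (linearly independent columns; $n$ is the rank), a target $\vec t\in\mathbb{Z}^m$ and $d>0$, distinguish YES instances (some $\vec z\in\{0,1\}^n$ has $\|\mathbf{B}\vec z-\vec t\|_2\le d$) from NO instances ($\|\mathbf{B}\vec z-\vec t\|_2>d$ for all $\vec z\in\{0,1\}^n$), where $\|\cdot\|_2$ is the Euclidean norm. Minimum-weight-$k$-Clique (on graphs, i.e. $2$-uniform hypergraphs): given a graph $G=(V,E)$, an edge weight function $w$, and a number $d$, distinguish YES instances, where some $k$-clique has total weight (sum of the weights of its $\binom{k}{2}$ edges) at most $d$, from NO instances, where every $k$-clique has total weight greater than $d$. A Karp reduction maps instances to instances, YES to YES and NO to NO.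
   Formalization: The distance d is taken rational, the time and space bounds gain a term O(|d|^2) with |d| the bit length of d (without it they fail, since d may be arbitrarily long), and eta is at least 1 (for eta = 0 the time bound would be zero). *)

theory Defs
  imports
    "HOL-Library.Log_Nat"
    "HOL-Library.Ramsey"
    "HOL-Analysis.L2_Norm"
    "Jordan_Normal_Form.DL_Rank"
begin

text \<open>A problem is the pair of its set of YES instances and its set of NO instances.\<close>

type_synonym 'i problem = "'i set \<times> 'i set"

definition karp_reduction :: "'i problem \<Rightarrow> 'j problem \<Rightarrow> ('i \<Rightarrow> 'j) \<Rightarrow> bool" where
  "karp_reduction A B f \<longleftrightarrow> (\<forall>x\<in>fst A. f x \<in> fst B) \<and> (\<forall>x\<in>snd A. f x \<in> snd B)"

text \<open>Instances are inputs of an algorithm, so the distance is rational.\<close>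

record cvp_instance =
  basis :: "int mat"
  target :: "int vec"
  distance :: rat

definition linearly_independent_cols :: "int mat \<Rightarrow> bool" where
  "linearly_independent_cols B \<longleftrightarrow>
     distinct (cols (map_mat real_of_int B)) \<and>
     module.lin_indpt class_ring (module_vec TYPE(real) (dim_row B))
       (set (cols (map_mat real_of_int B)))"

definition valid_cvp :: "nat \<Rightarrow> cvp_instance \<Rightarrow> bool" where
  "valid_cvp n I \<longleftrightarrow>
     dim_col (basis I) = n \<and> linearly_independent_cols (basis I) \<and>
     target I \<in> carrier_vec (dim_row (basis I)) \<and> distance I > 0"

definition l2_norm :: "int vec \<Rightarrow> real" where
  "l2_norm v = L2_set (\<lambda>i. real_of_int (v $ i)) {..<dim_vec v}"

definition binary_vecs :: "nat \<Rightarrow> int vec set" where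
  "binary_vecs n = {z \<in> carrier_vec n. \<forall>i<n. z $ i \<in> {0, 1}}"

definition cvp01 :: "nat \<Rightarrow> cvp_instance problem" where
  "cvp01 n =
     ({I. valid_cvp n I \<and>
        (\<exists>z\<in>binary_vecs n. l2_norm (basis I *\<^sub>v z - target I) \<le> real_of_rat (distance I))},
      {I. valid_cvp n I \<and>
        (\<forall>z\<in>binary_vecs n. l2_norm (basis I *\<^sub>v z - target I) > real_of_rat (distance I))})"

record 'v clique_instance =
  verts :: "'v set"
  edges :: "'v set set"
  weight :: "'v set \<Rightarrow> rat"
  threshold :: rat

text \<open>\<open>[K]\<^bsup>2\<^esup>\<close> is the set of two-element subsets of \<open>K\<close>.\<close>

definition valid_graph :: "nat \<Rightarrow> 'v clique_instance \<Rightarrow> bool" where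
  "valid_graph N G \<longleftrightarrow> finite (verts G) \<and> card (verts G) = N \<and> edges G \<subseteq> [verts G]\<^bsup>2\<^esup>"

definition k_cliques :: "nat \<Rightarrow> 'v clique_instance \<Rightarrow> 'v set set" where
  "k_cliques k G = {K \<in> [verts G]\<^bsup>k\<^esup>. [K]\<^bsup>2\<^esup> \<subseteq> edges G}"

definition min_weight_clique :: "nat \<Rightarrow> nat \<Rightarrow> 'v clique_instance problem" where
  "min_weight_clique k N =
     ({G. valid_graph N G \<and> (\<exists>K\<in>k_cliques k G. (\<Sum>e\<in>[K]\<^bsup>2\<^esup>. weight G e) \<le> threshold G)},
      {G. valid_graph N G \<and> (\<forall>K\<in>k_cliques k G. (\<Sum>e\<in>[K]\<^bsup>2\<^esup>. weight G e) > threshold G)})"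

text \<open>
  Programs work on finitely many arrays of integer cells; \<open>s A i\<close> is cell \<open>i\<close> of array \<open>A\<close>.
  Numbers that do not fit in a \<open>w\<close>-bit word are allowed, but are charged for: an \<open>L\<close>-bit
  magnitude and a sign occupy \<open>L div w + 1\<close> words, reading, writing, comparing, adding and
  subtracting cost the number of words involved, and multiplication has the schoolbook cost.
  Addresses are charged in the same way. The intended word size is logarithmic in the size of
  input and output: a word can hold the number of rows and the number of vertices.
\<close>

type_synonym mem = "nat \<Rightarrow> nat \<Rightarrow> int"

definition bits :: "int \<Rightarrow> nat" where
  "bits x = floorlog 2 (nat \<bar>x\<bar>)"

definition words :: "nat \<Rightarrow> int \<Rightarrow> nat" where
  "words w x = bits x div w + 1"

datatype expr =
    Num int
  | Cell nat expr
  | Add expr expr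
  | Sub expr expr
  | Mul expr expr

fun val :: "mem \<Rightarrow> expr \<Rightarrow> int" where
  "val s (Num x) = x"
| "val s (Cell A e) = s A (nat (val s e))"
| "val s (Add e1 e2) = val s e1 + val s e2"
| "val s (Sub e1 e2) = val s e1 - val s e2"
| "val s (Mul e1 e2) = val s e1 * val s e2"

fun expr_time :: "nat \<Rightarrow> mem \<Rightarrow> expr \<Rightarrow> nat" where
  "expr_time w s (Num x) = words w x"
| "expr_time w s (Cell A e) =
     expr_time w s e + words w (val s e) + words w (val s (Cell A e))"
| "expr_time w s (Add e1 e2) =
     expr_time w s e1 + expr_time w s e2 + words w (val s e1) + words w (val s e2)"
| "expr_time w s (Sub e1 e2) =
     expr_time w s e1 + expr_time w s e2 + words w (val s e1) + words w (val s e2)"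
| "expr_time w s (Mul e1 e2) =
     expr_time w s e1 + expr_time w s e2 + words w (val s e1) * words w (val s e2)"

text \<open>\<open>Assign A e1 e2\<close> stores the value of \<open>e2\<close> in cell \<open>e1\<close> of array \<open>A\<close>.\<close>

datatype com =
    Skip
  | Assign nat expr expr
  | Seq com com
  | IfLess expr expr com com
  | WhileLess expr expr com

text \<open>
  Words occupied by the nonzero cells together with their addresses. Memories reached from an
  input have finitely many nonzero cells. Intermediate values of expressions are not counted:
  a program evaluates expressions of bounded size only, so they change space by a constant factor.
\<close>

definition mem_space :: "nat \<Rightarrow> mem \<Rightarrow> nat" where
  "mem_space w s = (\<Sum>(A, i) | s A i \<noteq> 0. words w (int i) + words w (s A i))"

text \<open>
  \<open>run w c s s' T S\<close>: with word size \<open>w\<close>, the program \<open>c\<close> started in \<open>s\<close> halts in \<open>s'\<close> after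
  time \<open>T\<close>, and \<open>S\<close> is the maximum of \<^const>\<open>mem_space\<close> over all memories met on the way.
\<close>

inductive run :: "nat \<Rightarrow> com \<Rightarrow> mem \<Rightarrow> mem \<Rightarrow> nat \<Rightarrow> nat \<Rightarrow> bool" for w where
  Skip: "run w Skip s s 1 (mem_space w s)"
| Assign: "s' = s(A := (s A)(nat (val s e1) := val s e2)) \<Longrightarrow>
    run w (Assign A e1 e2) s s'
      (expr_time w s e1 + expr_time w s e2 + words w (val s e1) + words w (val s e2))
      (max (mem_space w s) (mem_space w s'))"
| Seq: "run w c1 s s' T1 S1 \<Longrightarrow> run w c2 s' s'' T2 S2 \<Longrightarrow>
    run w (Seq c1 c2) s s'' (T1 + T2) (max S1 S2)"
| IfTrue: "val s e1 < val s e2 \<Longrightarrow> run w c1 s s' T S \<Longrightarrow>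
    run w (IfLess e1 e2 c1 c2) s s'
      (expr_time w s e1 + expr_time w s e2 + words w (val s e1) + words w (val s e2) + T) S"
| IfFalse: "\<not> val s e1 < val s e2 \<Longrightarrow> run w c2 s s' T S \<Longrightarrow>
    run w (IfLess e1 e2 c1 c2) s s'
      (expr_time w s e1 + expr_time w s e2 + words w (val s e1) + words w (val s e2) + T) S"
| WhileTrue: "val s e1 < val s e2 \<Longrightarrow> run w c s s' T1 S1 \<Longrightarrow>
    run w (WhileLess e1 e2 c) s' s'' T2 S2 \<Longrightarrow>
    run w (WhileLess e1 e2 c) s s''
      (expr_time w s e1 + expr_time w s e2 + words w (val s e1) + words w (val s e2) + T1 + T2)
      (max S1 S2)"
| WhileFalse: "\<not> val s e1 < val s e2 \<Longrightarrow>
    run w (WhileLess e1 e2 c) s s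
      (expr_time w s e1 + expr_time w s e2 + words w (val s e1) + words w (val s e2))
      (mem_space w s)"

lemma run_deterministic:
  "run w c s s1 T1 S1 \<Longrightarrow> run w c s s2 T2 S2 \<Longrightarrow> s1 = s2 \<and> T1 = T2 \<and> S1 = S2"
proof (induction arbitrary: s2 T2 S2 rule: run.induct)
  case (Skip s)
  then show ?case by (auto elim: run.cases)
next
  case (Assign s' s A e1 e2)
  from Assign.prems Assign.hyps show ?case by cases auto
next
  case (Seq c1 s s' T1 S1 c2 s'' T2' S2')
  from Seq.prems show ?case by cases (use Seq.IH in blast)
next
  case (IfTrue s e1 e2 c1 s' T S c2)
  from IfTrue.prems show ?case
    by cases (use IfTrue.IH IfTrue.hyps in blast)+
next
  case (IfFalse s e1 e2 c2 s' T S c1)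
  from IfFalse.prems show ?case
    by cases (use IfFalse.IH IfFalse.hyps in blast)+
next
  case (WhileTrue s e1 e2 c s' T1 S1 s'' T2' S2')
  from WhileTrue.prems show ?case
    by cases (use WhileTrue.IH WhileTrue.hyps in blast)+
next
  case (WhileFalse s e1 e2 c)
  from WhileFalse.prems show ?case
    by cases (use WhileFalse.hyps in auto)
qed

text \<open>
  Array 0 holds \<open>n\<close>, \<open>k\<close>, \<open>m\<close> and the numerator and denominator (in lowest terms) of the
  distance, array 1 the basis, column after column, and array 2 the target.
\<close>

definition cvp_input :: "nat \<Rightarrow> nat \<Rightarrow> cvp_instance \<Rightarrow> mem" where
  "cvp_input n k I = (let m = dim_row (basis I); (p, q) = quotient_of (distance I) in
     (\<lambda>_ _. 0)
       (0 := (\<lambda>i. if i < 5 then [int n, int k, int m, p, q] ! i else 0),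
        1 := (\<lambda>i. if i < m * n then basis I $$ (i mod m, i div m) else 0),
        2 := (\<lambda>i. if i < m then target I $ i else 0)))"

text \<open>
  An output graph has vertices \<open>0, \<dots>, N - 1\<close>. Array 3 is its adjacency matrix, row after row;
  arrays 4 and 5 hold the numerators and denominators of the weights of the edges in the same
  order, and array 6 holds the numerator and denominator of the threshold, followed by \<open>N\<close>.
\<close>

definition clique_output :: "mem \<Rightarrow> nat \<Rightarrow> nat clique_instance \<Rightarrow> bool" where
  "clique_output s N G \<longleftrightarrow>
     verts G = {..<N} \<and>
     (\<forall>u<N. \<forall>v<N.
        s 3 (u * N + v) = (if {u, v} \<in> edges G then 1 else 0) \<and>
        ({u, v} \<in> edges G \<longrightarrow>
           s 5 (u * N + v) > 0 \<and>
           weight G {u, v} = of_int (s 4 (u * N + v)) / of_int (s 5 (u * N + v)))) \<and>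
     s 6 1 > 0 \<and> threshold G = of_int (s 6 0) / of_int (s 6 1) \<and> s 6 2 = int N"

definition num_verts :: "nat \<Rightarrow> nat \<Rightarrow> nat" where
  "num_verts n k = k * 2 ^ nat \<lceil>real n / real k\<rceil>"

definition coords_bounded :: "nat \<Rightarrow> cvp_instance \<Rightarrow> bool" where
  "coords_bounded \<eta> I \<longleftrightarrow>
     (\<forall>i < dim_row (basis I). \<forall>j < dim_col (basis I). \<bar>basis I $$ (i, j)\<bar> \<le> 2 ^ \<eta>) \<and>
     (\<forall>i < dim_vec (target I). \<bar>target I $ i\<bar> \<le> 2 ^ \<eta>)"

definition rat_bits :: "rat \<Rightarrow> nat" where
  "rat_bits x = bits (fst (quotient_of x)) + bits (snd (quotient_of x))"

end

theory Submission
  imports Defs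
begin

text \<open>
  Split the \<open>n\<close> coordinates into \<open>k\<close> blocks of length \<open>q = \<lceil>n / k\<rceil>\<close>; the vertices of the graph are
  the \<open>2 ^ q\<close> partial assignments of each block, and two vertices are adjacent iff they belong to
  different blocks. A \<open>k\<close>-clique then is a choice of one partial assignment per block, that is, a vector
  \<open>z \<in> {0, 1}^n\<close>. With \<open>b u\<close> the partial sum of basis vectors selected by the vertex \<open>u\<close>, the edge \<open>{u, v}\<close>
  gets the weight
  \<open>2 (k - 1) \<langle>b u, b v\<rangle> + \<langle>b u, b u - 2 t\<rangle> + \<langle>b v, b v - 2 t\<rangle>\<close> up to a constant factor: each vertex
  of a clique lies on \<open>k - 1\<close> of its edges, so the total is
  \<open>(k - 1) (\<parallel>\<Sum>b u - t\<parallel>\<^sup>2 - \<parallel>t\<parallel>\<^sup>2)\<close>.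

  For the running time, all cells that the loops touch have \<open>O(\<eta> w)\<close> bits, so a basic command costs
  \<open>O(\<eta>\<^sup>2)\<close> and it suffices to count basic commands, of which there are \<open>O(m N\<^sup>2)\<close>. Only the first and the
  last few commands handle the distance. The space exceeds that of the input by at most the time.
\<close>

subsection \<open>Bit lengths\<close>

text \<open>The length of the distance is not bounded in terms of \<eta>, so one width for all cells
  would charge every loop step for the distance. A triple therefore carries a set \<open>D\<close>
  of arrays: its commands read from these only, and only their cells have to stay short. The loops
  run with \<open>D = - {0}\<close>, which hides the distance in array 0, and with cells of
  \<open>10 * \<eta>\<close> words. The three loading and three output assignments see all arrays
  and pay for cells of \<open>10 * \<eta> + 2 * R\<close> words, where \<open>R\<close> bounds the
  length of the numerator and of the denominator of the distance; this is the origin of the summand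
  \<open>R\<^sup>2\<close> in the time and space bounds.

  The program is not given \<eta>: the parameter belongs to the analysis alone, and the bounds have
  to hold for every admissible \<eta> about one and the same run.\<close>

lemma bits_le_iff: "bits x \<le> L \<longleftrightarrow> \<bar>x\<bar> < 2 ^ L"
proof -
  have "bits x \<le> L \<longleftrightarrow> nat \<bar>x\<bar> < 2 ^ L"
    by (simp add: bits_def floorlog_le_iff)
  also have "\<dots> \<longleftrightarrow> \<bar>x\<bar> < 2 ^ L"
    by (simp add: nat_less_iff)
  finally show ?thesis .
qed

lemma abs_less_bits: "\<bar>x\<bar> < 2 ^ bits x"
  using bits_le_iff by blast

lemma bits_add: "bits (x + y) \<le> max (bits x) (bits y) + 1"
proof -
  have "\<bar>x\<bar> < 2 ^ max (bits x) (bits y)" "\<bar>y\<bar> < 2 ^ max (bits x) (bits y)"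
    by (auto simp flip: bits_le_iff)
  then show ?thesis by (simp add: bits_le_iff)
qed

lemma bits_minus [simp]: "bits (- x) = bits x"
  by (simp add: bits_def)

lemma bits_diff: "bits (x - y) \<le> max (bits x) (bits y) + 1"
  using bits_add[of x "- y"] by simp

lemma bits_mult: "bits (x * y) \<le> bits x + bits y"
proof -
  have "\<bar>x\<bar> * \<bar>y\<bar> < 2 ^ bits x * 2 ^ bits y"
    using abs_less_bits by (intro mult_strict_mono') auto
  then show ?thesis by (simp add: bits_le_iff abs_mult power_add)
qed

lemma bits_0 [simp]: "bits 0 = 0"
  by (simp add: bits_def floorlog_def)

lemma bits_nat_le: "bits (int (nat x)) \<le> bits x"
  by (cases "x \<ge> 0") auto

lemma words_mono: "bits x \<le> bits y \<Longrightarrow> words w x \<le> words w y"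
  by (simp add: words_def div_le_mono)

lemma words_le: "0 < w \<Longrightarrow> bits x \<le> c * w \<Longrightarrow> words w x \<le> c + 1"
  unfolding words_def by (metis add_le_mono1 div_le_mono nonzero_mult_div_cancel_right not_gr0)

subsection \<open>Space\<close>

text \<open>\<open>mem_space\<close> is a sum over the support and would collapse to 0 if the
  support were infinite, so finiteness travels with the bound. The words released by the overwritten
  value are ignored.\<close>

lemma mem_space_update:
  fixes s :: mem and A i :: nat and x :: int
  assumes "finite {(A, i). s A i \<noteq> 0}"
  defines "s' \<equiv> s(A := (s A)(i := x))"
  shows "finite {(A, i). s' A i \<noteq> 0}"
    and "mem_space w s' \<le> mem_space w s + words w (int i) + words w x"
proof -
  let ?S = "{(A, i). s A i \<noteq> 0}" and ?S' = "{(A, i). s' A i \<noteq> 0}"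
  have sub: "?S' \<subseteq> insert (A, i) (?S - {(A, i)})"
    by (auto simp: s'_def split: if_splits)
  show fin: "finite ?S'"
    using finite_subset[OF sub] assms(1) by simp
  let ?g = "\<lambda>s (A, i). words w (int i) + words w (s A i :: int)"
  have "mem_space w s' \<le> (\<Sum>y\<in>insert (A, i) (?S - {(A, i)}). ?g s' y)"
    unfolding mem_space_def
    by (rule order_trans[OF sum_mono2[OF _ sub]]) (use assms(1) in auto)
  also have "\<dots> = ?g s' (A, i) + (\<Sum>y\<in>?S - {(A, i)}. ?g s' y)"
    using assms(1) by (subst sum.insert) auto
  also have "(\<Sum>y\<in>?S - {(A, i)}. ?g s' y) = (\<Sum>y\<in>?S - {(A, i)}. ?g s y)"
  proof (rule sum.cong)
    fix y assume "y \<in> ?S - {(A, i)}"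
    then show "?g s' y = ?g s y" by (cases y) (auto simp: s'_def)
  qed simp
  also have "\<dots> \<le> (\<Sum>y\<in>?S. ?g s y)"
    using assms(1) by (intro sum_mono2) auto
  also have "\<dots> = mem_space w s"
    by (simp add: mem_space_def)
  finally show "mem_space w s' \<le> mem_space w s + words w (int i) + words w x"
    by (simp add: s'_def fun_upd_def)
qed

text \<open>An assignment is charged at least the words of the address and of the value that it
  writes, and it cannot enlarge the memory by more; \<open>Skip\<close> and tests write nothing. So
  time pays for space.\<close>

lemma run_space:
  assumes "run w c s s' T S" "finite {(A, i). s A i \<noteq> 0}"
  shows "finite {(A, i). s' A i \<noteq> 0} \<and> mem_space w s' \<le> mem_space w s + T
    \<and> S \<le> mem_space w s + T"
  using assms
proof (induction rule: run.induct)
  case (Assign s' s A e1 e2)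
  note upd = mem_space_update[OF Assign.prems, where A = A and i = "nat (val s e1)" and x = "val s e2", folded Assign.hyps]
  have "words w (int (nat (val s e1))) \<le> words w (val s e1)"
    by (intro words_mono bits_nat_le)
  then show ?case
    using upd(1) upd(2)[of w] by simp
qed force+

subsection \<open>Time\<close>

text \<open>If cells have at most \<open>L\<close> bits, values have at most
  \<open>leaves e * L\<close> bits. A cell is a single leaf however large its index, since only its
  content enters the value.\<close>

fun leaves :: "expr \<Rightarrow> nat" where
  "leaves (Num x) = 1"
| "leaves (Cell A e) = 1"
| "leaves (Add e1 e2) = leaves e1 + leaves e2"
| "leaves (Sub e1 e2) = leaves e1 + leaves e2"
| "leaves (Mul e1 e2) = leaves e1 + leaves e2"

text \<open>\<open>expr_time\<close> with each \<open>words w\<close> replaced by its bound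
  \<open>leaves + 1\<close> in units of \<open>W\<close>. Multiplication makes the cost quadratic,
  so the result is a coefficient of \<open>W\<^sup>2\<close>.\<close>

fun expr_cost :: "expr \<Rightarrow> nat" where
  "expr_cost (Num x) = 2"
| "expr_cost (Cell A e) = expr_cost e + (leaves e + 1) + 2"
| "expr_cost (Add e1 e2) = expr_cost e1 + expr_cost e2 + (leaves e1 + 1) + (leaves e2 + 1)"
| "expr_cost (Sub e1 e2) = expr_cost e1 + expr_cost e2 + (leaves e1 + 1) + (leaves e2 + 1)"
| "expr_cost (Mul e1 e2) = expr_cost e1 + expr_cost e2 + (leaves e1 + 1) * (leaves e2 + 1)"

definition pair_cost :: "expr \<Rightarrow> expr \<Rightarrow> nat" where
  "pair_cost e1 e2 = expr_cost e1 + expr_cost e2 + (leaves e1 + 1) + (leaves e2 + 1)"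

fun reads :: "expr \<Rightarrow> nat set" where
  "reads (Num x) = {}"
| "reads (Cell A e) = insert A (reads e)"
| "reads (Add e1 e2) = reads e1 \<union> reads e2"
| "reads (Sub e1 e2) = reads e1 \<union> reads e2"
| "reads (Mul e1 e2) = reads e1 \<union> reads e2"

text \<open>The largest literal of the program is 4, the index of the denominator of the distance.
  Three bits suffice for it, which keeps literals within the budget of one leaf.\<close>

fun small_nums :: "expr \<Rightarrow> bool" where
  "small_nums (Num x) \<longleftrightarrow> \<bar>x\<bar> \<le> 4"
| "small_nums (Cell A e) \<longleftrightarrow> small_nums e"
| "small_nums (Add e1 e2) \<longleftrightarrow> small_nums e1 \<and> small_nums e2"
| "small_nums (Sub e1 e2) \<longleftrightarrow> small_nums e1 \<and> small_nums e2"
| "small_nums (Mul e1 e2) \<longleftrightarrow> small_nums e1 \<and> small_nums e2"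

definition fits :: "nat set \<Rightarrow> nat \<Rightarrow> mem \<Rightarrow> bool" where
  "fits D L s \<longleftrightarrow> (\<forall>A\<in>D. \<forall>i. bits (s A i) \<le> L)"

lemma leaves_pos [simp]: "0 < leaves e"
  by (induction e) auto

text \<open>In sums and differences the extra carry bit is paid for by the other operand, whose
  budget \<open>leaves * L\<close> is at least 1.\<close>

lemma bits_val:
  assumes "fits D L s" "reads e \<subseteq> D" "small_nums e" "3 \<le> L"
  shows "bits (val s e) \<le> leaves e * L"
  using assms(2,3)
proof (induction e)
  case (Num x)
  have "\<bar>x\<bar> < 2 ^ 3" using Num by simp
  then have "bits x \<le> 3" using bits_le_iff by blast
  then show ?case using assms(4) by simp
next
  case (Cell A e)
  then show ?case using assms(1) by (auto simp: fits_def)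
next
  case (Add e1 e2)
  have "1 \<le> leaves e1 * L" "1 \<le> leaves e2 * L"
    using assms(4) by (auto simp: Suc_le_eq)
  moreover have "bits (val s e1) \<le> leaves e1 * L" "bits (val s e2) \<le> leaves e2 * L"
    using Add by auto
  ultimately show ?case
    using bits_add[of "val s e1" "val s e2"] unfolding val.simps leaves.simps add_mult_distrib by linarith
next
  case (Sub e1 e2)
  have "1 \<le> leaves e1 * L" "1 \<le> leaves e2 * L"
    using assms(4) by (auto simp: Suc_le_eq)
  moreover have "bits (val s e1) \<le> leaves e1 * L" "bits (val s e2) \<le> leaves e2 * L"
    using Sub by auto
  ultimately show ?case
    using bits_diff[of "val s e1" "val s e2"] unfolding val.simps leaves.simps add_mult_distrib by linarith
next
  case (Mul e1 e2)
  then show ?case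
    using bits_mult[of "val s e1" "val s e2"] by (simp add: add_mult_distrib)
qed

context
  fixes w W :: nat and D s
  assumes fits: "fits D (W * w) s" and w: "1 \<le> w" and W: "3 \<le> W"
begin

lemma words_val:
  assumes "reads e \<subseteq> D" "small_nums e"
  shows "words w (val s e) \<le> (leaves e + 1) * W"
proof -
  have "3 \<le> W * w" using w W by (metis mult_le_mono mult.right_neutral)
  then have "bits (val s e) \<le> leaves e * W * w"
    using bits_val[OF fits assms] by (simp add: mult.assoc)
  then have "words w (val s e) \<le> leaves e * W + 1"
    using w by (intro words_le) auto
  then show ?thesis using W by simp
qed

lemma words_val2:
  assumes "reads e \<subseteq> D" "small_nums e"
  shows "words w (val s e) \<le> (leaves e + 1) * W\<^sup>2"
  using words_val[OF assms] W
  by (meson le_trans mult_le_mono2 power2_nat_le_imp_le self_le_power zero_less_numeral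
      order_refl one_le_numeral)

lemma expr_time_le:
  assumes "reads e \<subseteq> D" "small_nums e"
  shows "expr_time w s e \<le> expr_cost e * W\<^sup>2"
  using assms
proof (induction e)
  case (Num x)
  then show ?case using words_val2[of "Num x"] by simp
next
  case (Cell A e)
  then show ?case using words_val2[of e] words_val2[of "Cell A e"] by (simp add: algebra_simps)
next
  case (Add e1 e2)
  then show ?case using words_val2[of e1] words_val2[of e2] by (simp add: algebra_simps)
next
  case (Sub e1 e2)
  then show ?case using words_val2[of e1] words_val2[of e2] by (simp add: algebra_simps)
next
  case (Mul e1 e2)
  have "words w (val s e1) * words w (val s e2) \<le> ((leaves e1 + 1) * W) * ((leaves e2 + 1) * W)"
    using Mul by (intro mult_le_mono words_val) auto
  then show ?case using Mul by (simp add: algebra_simps power2_eq_square)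
qed

text \<open>The limit 500 leaves some room: the costliest command of the program, the accumulation
  of an edge numerator, has \<open>pair_cost\<close> 377.\<close>

lemma basic_time_le:
  assumes "reads e1 \<union> reads e2 \<subseteq> D" "small_nums e1" "small_nums e2" "pair_cost e1 e2 \<le> 500"
  shows "expr_time w s e1 + expr_time w s e2 + words w (val s e1) + words w (val s e2)
    \<le> 500 * W\<^sup>2"
proof -
  have "expr_time w s e1 + expr_time w s e2 + words w (val s e1) + words w (val s e2)
    \<le> pair_cost e1 e2 * W\<^sup>2"
    using assms expr_time_le[of e1] expr_time_le[of e2] words_val2[of e1] words_val2[of e2]
    by (simp add: pair_cost_def algebra_simps)
  also have "\<dots> \<le> 500 * W\<^sup>2"
    using assms(4) by (rule mult_le_mono1)
  finally show ?thesis .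
qed

end

text \<open>
  Time is counted in units of \<open>500 * W\<^sup>2\<close>, an upper bound for the cost of an assignment or a test
  whose \<^const>\<open>pair_cost\<close> is at most \<open>500\<close> and whose cells have at most \<open>W * w\<close> bits.
\<close>

definition triple ::
  "nat \<Rightarrow> nat \<Rightarrow> nat set \<Rightarrow> (mem \<Rightarrow> bool) \<Rightarrow> com \<Rightarrow> (mem \<Rightarrow> bool) \<Rightarrow> nat \<Rightarrow> bool" where
  "triple w W D P c Q t \<longleftrightarrow> 1 \<le> w \<and> 3 \<le> W \<longrightarrow>
     (\<forall>s. fits D (W * w) s \<longrightarrow> P s \<longrightarrow>
       (\<exists>s' T S. run w c s s' T S \<and> T \<le> 500 * W\<^sup>2 * t \<and> fits D (W * w) s' \<and> Q s'))"

section \<open>Proof rules for timed triples\<close>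

lemma triple_Skip:
  assumes "\<And>s. P s \<Longrightarrow> Q s"
  shows "triple w W D P Skip Q 1"
  unfolding triple_def
proof (intro impI allI)
  fix s assume "1 \<le> w \<and> 3 \<le> W" "fits D (W * w) s" "P s"
  then show "\<exists>s' T S. run w Skip s s' T S \<and> T \<le> 500 * W\<^sup>2 * 1 \<and> fits D (W * w) s' \<and> Q s'"
    using run.Skip[of w s] assms[of s] by (intro exI conjI) (assumption | simp add: Suc_le_eq)+
qed

lemma triple_Assign:
  assumes "\<And>s. fits D (W * w) s \<Longrightarrow> P s \<Longrightarrow>
      Q (s(A := (s A)(nat (val s e1) := val s e2))) \<and> (A \<in> D \<longrightarrow> bits (val s e2) \<le> W * w)"
    and "reads e1 \<union> reads e2 \<subseteq> D" "small_nums e1" "small_nums e2" "pair_cost e1 e2 \<le> 500"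
  shows "triple w W D P (Assign A e1 e2) Q 1"
  unfolding triple_def
proof (intro impI allI)
  fix s assume *: "1 \<le> w \<and> 3 \<le> W" and s: "fits D (W * w) s" "P s"
  let ?s = "s(A := (s A)(nat (val s e1) := val s e2))"
  have "fits D (W * w) ?s"
    using s assms(1)[OF s] by (auto simp: fits_def)
  moreover have "expr_time w s e1 + expr_time w s e2 + words w (val s e1) + words w (val s e2)
      \<le> 500 * W\<^sup>2 * 1"
    using basic_time_le[OF s(1) _ _ assms(2-5)] * by simp
  ultimately show "\<exists>s' T S. run w (Assign A e1 e2) s s' T S \<and> T \<le> 500 * W\<^sup>2 * 1
      \<and> fits D (W * w) s' \<and> Q s'"
    using run.Assign[OF refl] assms(1)[OF s] by blast
qed

lemma triple_Seq:
  assumes "triple w W D P c1 Q t1" "triple w W D Q c2 R t2"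
  shows "triple w W D P (Seq c1 c2) R (t1 + t2)"
  unfolding triple_def
proof (intro impI allI)
  fix s assume *: "1 \<le> w \<and> 3 \<le> W" and s: "fits D (W * w) s" "P s"
  obtain s' T1 S1 where 1: "run w c1 s s' T1 S1" "T1 \<le> 500 * W\<^sup>2 * t1" "fits D (W * w) s'" "Q s'"
    using assms(1) * s unfolding triple_def by blast
  obtain s'' T2 S2 where 2: "run w c2 s' s'' T2 S2" "T2 \<le> 500 * W\<^sup>2 * t2" "fits D (W * w) s''" "R s''"
    using assms(2) * 1 unfolding triple_def by blast
  have "T1 + T2 \<le> 500 * W\<^sup>2 * (t1 + t2)"
    using 1(2) 2(2) by (simp add: algebra_simps)
  then show "\<exists>s' T S. run w (Seq c1 c2) s s' T S \<and> T \<le> 500 * W\<^sup>2 * (t1 + t2)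
      \<and> fits D (W * w) s' \<and> R s'"
    using run.Seq[OF 1(1) 2(1)] 2(3,4) by blast
qed

lemma triple_weaken:
  assumes "triple w W D P c Q t" "\<And>s. P' s \<Longrightarrow> P s" "\<And>s. Q s \<Longrightarrow> Q' s" "t \<le> t'"
  shows "triple w W D P' c Q' t'"
  unfolding triple_def
proof (intro impI allI)
  fix s assume *: "1 \<le> w \<and> 3 \<le> W" and s: "fits D (W * w) s" "P' s"
  obtain s' T S where 1: "run w c s s' T S" "T \<le> 500 * W\<^sup>2 * t" "fits D (W * w) s'" "Q s'"
    using assms(1,2) * s unfolding triple_def by blast
  have "T \<le> 500 * W\<^sup>2 * t'"
    using 1(2) mult_le_mono2[OF assms(4), of "500 * W\<^sup>2"] by linarith
  then show "\<exists>s' T S. run w c s s' T S \<and> T \<le> 500 * W\<^sup>2 * t' \<and> fits D (W * w) s' \<and> Q' s'"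
    using 1 assms(3) by blast
qed

lemma triple_If:
  assumes "triple w W D (\<lambda>s. P s \<and> val s e1 < val s e2) c1 Q t"
    and "triple w W D (\<lambda>s. P s \<and> \<not> val s e1 < val s e2) c2 Q t"
    and "reads e1 \<union> reads e2 \<subseteq> D" "small_nums e1" "small_nums e2" "pair_cost e1 e2 \<le> 500"
  shows "triple w W D P (IfLess e1 e2 c1 c2) Q (1 + t)"
  unfolding triple_def
proof (intro impI allI)
  fix s assume *: "1 \<le> w \<and> 3 \<le> W" and s: "fits D (W * w) s" "P s"
  let ?T = "expr_time w s e1 + expr_time w s e2 + words w (val s e1) + words w (val s e2)"
  have test: "?T \<le> 500 * W\<^sup>2"
    using basic_time_le[OF s(1) _ _ assms(3-6)] * by simp
  show "\<exists>s' T S. run w (IfLess e1 e2 c1 c2) s s' T S \<and> T \<le> 500 * W\<^sup>2 * (1 + t)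
      \<and> fits D (W * w) s' \<and> Q s'"
  proof (cases "val s e1 < val s e2")
    case True
    then obtain s' T S where 1: "run w c1 s s' T S" "T \<le> 500 * W\<^sup>2 * t" "fits D (W * w) s'" "Q s'"
      using assms(1) * s unfolding triple_def by blast
    have "?T + T \<le> 500 * W\<^sup>2 * (1 + t)"
      using 1(2) test by (simp add: algebra_simps)
    then show ?thesis using run.IfTrue[OF True 1(1)] 1(3,4) by blast
  next
    case False
    then obtain s' T S where 1: "run w c2 s s' T S" "T \<le> 500 * W\<^sup>2 * t" "fits D (W * w) s'" "Q s'"
      using assms(2) * s unfolding triple_def by blast
    have "?T + T \<le> 500 * W\<^sup>2 * (1 + t)"
      using 1(2) test by (simp add: algebra_simps)
    then show ?thesis using run.IfFalse[OF False 1(1)] 1(3,4) by blast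
  qed
qed

text \<open>The test is tied exactly to \<open>i < b\<close>, so termination needs no argument of
  its own: the induction descends from \<open>i = b\<close>, where the loop exits. Each round pays
  for the body and one test, the final 1 for the failing test.\<close>

lemma triple_While:
  assumes body: "\<And>i. i < b \<Longrightarrow> triple w W D (Inv i) c (Inv (Suc i)) t"
    and test: "\<And>i s. i \<le> b \<Longrightarrow> Inv i s \<Longrightarrow> val s e1 < val s e2 \<longleftrightarrow> i < b"
    and cost: "reads e1 \<union> reads e2 \<subseteq> D" "small_nums e1" "small_nums e2" "pair_cost e1 e2 \<le> 500"
  shows "triple w W D (Inv 0) (WhileLess e1 e2 c) (Inv b) (b * (t + 1) + 1)"
proof -
  have "triple w W D (Inv i) (WhileLess e1 e2 c) (Inv b) ((b - i) * (t + 1) + 1)" if "i \<le> b" for i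
    using that
  proof (induction rule: inc_induct)
    case base
    show ?case
      unfolding triple_def
    proof (intro impI allI)
      fix s assume *: "1 \<le> w \<and> 3 \<le> W" and s: "fits D (W * w) s" "Inv b s"
      have "\<not> val s e1 < val s e2" using test[of b s] s by simp
      moreover have "expr_time w s e1 + expr_time w s e2 + words w (val s e1) + words w (val s e2)
          \<le> 500 * W\<^sup>2 * ((b - b) * (t + 1) + 1)"
        using basic_time_le[OF s(1) _ _ cost] * by simp
      ultimately show "\<exists>s' T S. run w (WhileLess e1 e2 c) s s' T S
          \<and> T \<le> 500 * W\<^sup>2 * ((b - b) * (t + 1) + 1) \<and> fits D (W * w) s' \<and> Inv b s'"
        using run.WhileFalse s by blast
    qed
  next
    case (step i)
    show ?case
      unfolding triple_def
    proof (intro impI allI)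
      fix s assume *: "1 \<le> w \<and> 3 \<le> W" and s: "fits D (W * w) s" "Inv i s"
      have true: "val s e1 < val s e2" using test[of i s] s step.hyps by simp
      have T0: "expr_time w s e1 + expr_time w s e2 + words w (val s e1) + words w (val s e2)
          \<le> 500 * W\<^sup>2"
        using basic_time_le[OF s(1) _ _ cost] * by simp
      obtain s' T1 S1 where 1: "run w c s s' T1 S1" "T1 \<le> 500 * W\<^sup>2 * t" "fits D (W * w) s'"
          "Inv (Suc i) s'"
        using body[of i] step.hyps * s unfolding triple_def by blast
      obtain s'' T2 S2 where 2: "run w (WhileLess e1 e2 c) s' s'' T2 S2"
          "T2 \<le> 500 * W\<^sup>2 * ((b - Suc i) * (t + 1) + 1)" "fits D (W * w) s''" "Inv b s''"
        using step.IH * 1 unfolding triple_def by blast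
      have "b - i = Suc (b - Suc i)" using step.hyps by simp
      then have "500 * W\<^sup>2 * ((b - i) * (t + 1) + 1)
          = 500 * W\<^sup>2 + 500 * W\<^sup>2 * t + 500 * W\<^sup>2 * ((b - Suc i) * (t + 1) + 1)"
        by (simp add: algebra_simps)
      then have "expr_time w s e1 + expr_time w s e2 + words w (val s e1) + words w (val s e2) + T1 + T2
          \<le> 500 * W\<^sup>2 * ((b - i) * (t + 1) + 1)"
        using T0 1(2) 2(2) by linarith
      then show "\<exists>s' T S. run w (WhileLess e1 e2 c) s s' T S
          \<and> T \<le> 500 * W\<^sup>2 * ((b - i) * (t + 1) + 1) \<and> fits D (W * w) s' \<and> Inv b s'"
        using run.WhileTrue[OF true 1(1) 2(1)] 2(3,4) by blast
    qed
  qed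
  from this[of 0] show ?thesis by simp
qed

section \<open>Counting loops\<close>

abbreviation Var :: "nat \<Rightarrow> expr" where
  "Var A \<equiv> Cell A (Num 0)"

abbreviation assign_var :: "nat \<Rightarrow> expr \<Rightarrow> com" where
  "assign_var A e \<equiv> Assign A (Num 0) e"

definition for_loop :: "nat \<Rightarrow> nat \<Rightarrow> com \<Rightarrow> com" where
  "for_loop x b c = Seq (assign_var x (Num 0))
     (WhileLess (Var x) (Var b) (Seq c (assign_var x (Add (Var x) (Num 1)))))"

text \<open>By \<open>frame\<close> the invariant ignores the whole array of the counter, which can
  therefore be reset and incremented freely. A round costs body, increment and test; the final 2
  covers the initialisation and the failing test.\<close>

lemma triple_for:
  assumes body: "\<And>i. i < b \<Longrightarrow> triple w W D (\<lambda>s. Inv i s \<and> s x 0 = int i) c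
        (\<lambda>s. Inv (Suc i) s \<and> s x 0 = int i) t"
    and frame: "\<And>i s a. Inv i s \<Longrightarrow> Inv i (s(x := a))"
    and bound: "\<And>i s. Inv i s \<Longrightarrow> s y 0 = int b" "bits (int b) \<le> W * w" "x \<noteq> y" "{x, y} \<subseteq> D"
  shows "triple w W D (Inv 0) (for_loop x y c) (Inv b) (b * (t + 2) + 2)"
proof -
  have bits_le: "bits (int i) \<le> W * w" if "i \<le> b" for i
    using that bound(2) by (simp add: bits_le_iff)
  have 1: "triple w W D (Inv 0) (assign_var x (Num 0)) (\<lambda>s. Inv 0 s \<and> s x 0 = int 0) 1"
    by (rule triple_Assign) (use frame in \<open>auto simp: pair_cost_def\<close>)
  have "triple w W D (\<lambda>s. Inv i s \<and> s x 0 = int i) (Seq c (assign_var x (Add (Var x) (Num 1))))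
      (\<lambda>s. Inv (Suc i) s \<and> s x 0 = int (Suc i)) (t + 1)" if "i < b" for i
  proof (rule triple_Seq[OF body[OF that]])
    have "bits (1 + int i) \<le> W * w" using bits_le[of "Suc i"] that by simp
    then show "triple w W D (\<lambda>s. Inv (Suc i) s \<and> s x 0 = int i) (assign_var x (Add (Var x) (Num 1)))
        (\<lambda>s. Inv (Suc i) s \<and> s x 0 = int (Suc i)) 1"
      by (intro triple_Assign) (use frame bound(4) in \<open>auto simp: pair_cost_def add.commute\<close>)
  qed
  then have "triple w W D (\<lambda>s. Inv 0 s \<and> s x 0 = int 0)
      (WhileLess (Var x) (Var y) (Seq c (assign_var x (Add (Var x) (Num 1)))))
      (\<lambda>s. Inv b s \<and> s x 0 = int b) (b * ((t + 1) + 1) + 1)"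
  proof (intro triple_While[where Inv = "\<lambda>i s. Inv i s \<and> s x 0 = int i"])
    fix i s assume "Inv i s \<and> s x 0 = int i"
    then show "val s (Var x) < val s (Var y) \<longleftrightarrow> i < b"
      using bound(1)[of i s] by simp
  qed (use bound(4) in \<open>auto simp: pair_cost_def\<close>)
  from triple_Seq[OF 1 this] show ?thesis
    unfolding for_loop_def by (rule triple_weaken) auto
qed

lemma triple_for_weaken:
  assumes "\<And>s. P s \<Longrightarrow> Inv 0 s" "\<And>s. Inv b s \<Longrightarrow> Q s" "b * (t + 2) + 2 = t'"
    and "\<And>i s. Inv i s \<Longrightarrow> s y 0 = int b" "bits (int b) \<le> W * w" "x \<noteq> y" "{x, y} \<subseteq> D"
    and "\<And>i s a. Inv i s \<Longrightarrow> Inv i (s(x := a))"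
    and "\<And>i. i < b \<Longrightarrow> triple w W D (\<lambda>s. Inv i s \<and> s x 0 = int i) c
        (\<lambda>s. Inv (Suc i) s \<and> s x 0 = int i) t"
  shows "triple w W D P (for_loop x y c) Q t'"
proof (rule triple_weaken[where P = "Inv 0" and Q = "Inv b"])
  show "triple w W D (Inv 0) (for_loop x y c) (Inv b) (b * (t + 2) + 2)"
    by (rule triple_for) (fact assms)+
qed (use assms in auto)

subsection \<open>The program\<close>

text \<open>
  Bit \<open>j < q\<close> of the vertex \<open>u\<close> is the coefficient of column \<open>j\<close> of the block \<open>u div 2 ^ q\<close>. The array \<open>B\<close>
  is column-major and zero past its end, which pads the last blocks if \<open>k\<close> does not divide \<open>n\<close>.
\<close>

definition vertex_vec :: "nat \<Rightarrow> nat \<Rightarrow> (nat \<Rightarrow> int) \<Rightarrow> nat \<Rightarrow> nat \<Rightarrow> int" where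
  "vertex_vec q m B u r = (\<Sum>j<q. of_bool (bit u j) * B ((u div 2 ^ q * q + j) * m + r))"

text \<open>The contribution of one coordinate to a weight. Expanded it is \<open>2 * (k - 1) * b *
  c + (b\<^sup>2 - 2 * t * b) + (c\<^sup>2 - 2 * t * c)\<close>, which is symmetric in
  \<open>b\<close> and \<open>c\<close>.\<close>

definition edge_term :: "int \<Rightarrow> int \<Rightarrow> int \<Rightarrow> int \<Rightarrow> int" where
  "edge_term k t b c = b * (2 * (k - 1) * c + b - 2 * t) + c * (c - 2 * t)"

definition edge_num :: "nat \<Rightarrow> nat \<Rightarrow> nat \<Rightarrow> (nat \<Rightarrow> int) \<Rightarrow> (nat \<Rightarrow> int) \<Rightarrow> nat \<Rightarrow> nat \<Rightarrow> int" where
  "edge_num k q m B t u v =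
     (\<Sum>r<m. edge_term (int k) (t r) (vertex_vec q m B u r) (vertex_vec q m B v r))"

text \<open>
  Variables live in cell 0 of an array of their own: 7, 8, 9 hold \<open>n\<close>, \<open>k\<close>, \<open>m\<close>; 10, 11, 12 hold \<open>q\<close>, \<open>2 ^ q\<close>,
  \<open>N\<close>; 15 to 18 are loop counters, 19 is a power of two, 20 is the squared norm of the target. Array 13
  stores the vectors of the vertices, array 14 their blocks.
\<close>

definition load_code :: com where
  "load_code = Seq (assign_var 7 (Cell 0 (Num 0)))
     (Seq (assign_var 8 (Cell 0 (Num 1))) (assign_var 9 (Cell 0 (Num 2))))"

text \<open>Programs cannot divide, so \<open>q\<close> is found as the first value with
  \<open>q * k \<ge> n\<close>, while \<open>2 ^ q\<close> grows alongside by doubling. Array 10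
  starts from the zero of fresh memory.\<close>

definition size_code :: com where
  "size_code = Seq (assign_var 11 (Num 1))
     (Seq (WhileLess (Mul (Var 10) (Var 8)) (Var 7)
             (Seq (assign_var 10 (Add (Var 10) (Num 1))) (assign_var 11 (Add (Var 11) (Var 11)))))
        (assign_var 12 (Mul (Var 8) (Var 11))))"

abbreviation block_vertex :: "expr \<Rightarrow> expr" where
  "block_vertex x \<equiv> Add (Mul (Var 15) (Var 11)) x"

text \<open>Another substitute for division: later code looks up \<open>u div 2 ^ q\<close> in array
  14.\<close>

definition block_code :: com where
  "block_code = for_loop 15 8 (for_loop 16 11 (Assign 14 (block_vertex (Var 16)) (Var 15)))"

abbreviation row_entry :: "expr \<Rightarrow> expr" where
  "row_entry u \<equiv> Add (Mul u (Var 9)) (Var 18)"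

text \<open>Vertex \<open>2 ^ j + x\<close> of a block, for \<open>x < 2 ^ j\<close>, arises from vertex \<open>x\<close> by adding column \<open>j\<close>.\<close>

definition table_code :: com where
  "table_code = for_loop 15 8 (Seq (assign_var 19 (Num 1))
     (for_loop 16 10 (Seq
        (for_loop 17 19 (for_loop 18 9
           (Assign 13 (row_entry (block_vertex (Add (Var 19) (Var 17))))
              (Add (Cell 13 (row_entry (block_vertex (Var 17))))
                 (Cell 1 (row_entry (Add (Mul (Var 15) (Var 10)) (Var 16))))))))
        (assign_var 19 (Add (Var 19) (Var 19))))))"

abbreviation edge_index :: expr where
  "edge_index \<equiv> Add (Mul (Var 15) (Var 12)) (Var 16)"

definition edge_expr :: "expr \<Rightarrow> expr \<Rightarrow> expr \<Rightarrow> expr \<Rightarrow> expr" where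
  "edge_expr k t b c = Add
     (Mul b (Sub (Add (Mul (Mul (Num 2) (Sub k (Num 1))) c) b) (Mul (Num 2) t)))
     (Mul c (Sub c (Mul (Num 2) t)))"

text \<open>As \<open><\<close> is the only test, blocks are recognised as different by the positive
  square of their difference. All ordered pairs are visited; those inside a block keep the initial
  adjacency entry 0.\<close>

definition edge_code :: com where
  "edge_code = for_loop 15 12 (for_loop 16 12 (Seq
     (Assign 5 edge_index (Mul (Sub (Var 8) (Num 1)) (Mul (Var 10) (Var 10))))
     (Seq
        (IfLess (Num 0) (Mul (Sub (Cell 14 (Var 15)) (Cell 14 (Var 16)))
                             (Sub (Cell 14 (Var 15)) (Cell 14 (Var 16))))
           (Assign 3 edge_index (Num 1)) Skip)
        (for_loop 18 9 (Assign 4 edge_index (Add (Cell 4 edge_index)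
           (edge_expr (Var 8) (Cell 2 (Var 18)) (Cell 13 (row_entry (Var 15)))
              (Cell 13 (row_entry (Var 16))))))))))"

definition target_code :: com where
  "target_code = for_loop 18 9
     (assign_var 20 (Add (Var 20) (Mul (Cell 2 (Var 18)) (Cell 2 (Var 18)))))"

text \<open>For the distance \<open>p / d\<close>, the threshold is brought to the common
  denominator \<open>d\<^sup>2 * q\<^sup>2\<close>; \<open>p\<close> and \<open>d\<close> are cells
  3 and 4 of array 0.\<close>

definition output_code :: com where
  "output_code = Seq (Assign 6 (Num 0) (Sub (Mul (Cell 0 (Num 3)) (Cell 0 (Num 3)))
       (Mul (Mul (Cell 0 (Num 4)) (Cell 0 (Num 4))) (Var 20))))
     (Seq (Assign 6 (Num 1) (Mul (Mul (Cell 0 (Num 4)) (Cell 0 (Num 4))) (Mul (Var 10) (Var 10))))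
        (Assign 6 (Num 2) (Var 12)))"

text \<open>Every array is filled in the order of its cells, so that loop invariants have the form \<open>s A = fill l f\<close>.\<close>

definition fill :: "nat \<Rightarrow> (nat \<Rightarrow> int) \<Rightarrow> nat \<Rightarrow> int" where
  "fill l f = (\<lambda>a. if a < l then f a else 0)"

lemma fill_0 [simp]: "fill 0 f = (\<lambda>_. 0)"
  by (simp add: fill_def)

lemma fill_update: "(fill l f)(l := f l) = fill (Suc l) f"
  by (auto simp: fill_def fun_eq_iff)

text \<open>Serves for stretches that are never written because their values are zero: the first
  vertex of each block in the table, and the non-adjacent pairs.\<close>

lemma fill_extend:
  assumes "l \<le> l'" "\<And>a. l \<le> a \<Longrightarrow> a < l' \<Longrightarrow> f a = 0"
  shows "fill l f = fill l' f"
  using assms by (auto simp: fill_def fun_eq_iff not_less)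

definition main_code :: com where
  "main_code = Seq size_code (Seq block_code (Seq table_code (Seq edge_code target_code)))"

definition program_code :: com where
  "program_code = Seq load_code (Seq main_code output_code)"

section \<open>Sizes of the numbers that occur\<close>

locale clique_program =
  fixes w \<eta> n k m q M N :: nat and h B t :: "nat \<Rightarrow> int"
  assumes n: "1 \<le> n" and k: "2 \<le> k" and m: "1 \<le> m" and \<eta>: "1 \<le> \<eta>"
    and q: "q = nat \<lceil>real n / real k\<rceil>" and M: "M = 2 ^ q" and N: "N = k * M"
    and size: "m + N \<le> 2 ^ w"
    and B: "\<And>a. \<bar>B a\<bar> \<le> 2 ^ \<eta>" and t: "\<And>a. \<bar>t a\<bar> \<le> 2 ^ \<eta>"
begin

abbreviation L :: nat where
  "L \<equiv> 10 * \<eta> * w"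

text \<open>The left side is the loop test of \<open>size_code\<close>, which hence succeeds exactly
  \<open>q\<close> times.\<close>

lemma less_q: "i * k < n \<longleftrightarrow> i < q"
proof -
  have "i * k < n \<longleftrightarrow> real i * real k < real n"
    by (simp flip: of_nat_mult)
  also have "\<dots> \<longleftrightarrow> real i < real n / real k"
    using k by (simp add: field_simps)
  also have "\<dots> \<longleftrightarrow> i < q"
    unfolding q by (auto simp: less_ceiling_iff zless_nat_eq_int_zless)
  finally show ?thesis .
qed

lemma q_pos: "0 < q"
  using less_q[of 0] n by simp

lemma n_le: "n \<le> q * k"
  using less_q[of q] by simp

lemma q_le_M: "q < M"
  by (simp add: M less_exp)

lemma M_le_N: "M \<le> N" and k_le_N: "k \<le> N" and N_pos: "0 < N"
  using k M by (simp_all add: N)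

lemma int_N: "int k * int M = int N" and int_M: "2 ^ q = int M" and M_mult_k: "M * k = N"
  by (simp_all add: N M)

lemma n_le_N: "n \<le> N"
  using n_le mult_le_mono1[of q M k] q_le_M unfolding N mult.commute[of k] by linarith

lemma m_le_w: "m < 2 ^ w" and N_le_w: "N < 2 ^ w"
  using size m N_pos by simp_all

lemma w_pos: "1 \<le> w"
  using N_le_w N_pos by (cases w) auto

lemma le_w: "x \<le> 2 ^ w" if "x \<le> N \<or> x \<le> m" for x
  using that m_le_w N_le_w by linarith

text \<open>The left side is the exponent needed for partial edge sums. The product
  \<open>10 * \<eta> * w\<close> is used in its place because it is a whole number
  \<open>10 * \<eta>\<close> of words; it dominates by
  \<open>w + \<eta> - 1 \<le> \<eta> * w\<close>.\<close>

lemma less_L: "4 * w + 2 * \<eta> + 2 < L"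
proof -
  have "4 * w + 2 * \<eta> + 2 < 10 * (w + \<eta> - 1)" using w_pos \<eta> by simp
  also have "w + \<eta> - 1 \<le> \<eta> * w"
    using w_pos \<eta> by (cases w; cases \<eta>) auto
  finally show ?thesis by simp
qed

lemma bits_le_L: "bits x \<le> L" if "\<bar>x\<bar> \<le> 2 ^ e" "e \<le> 4 * w + 2 * \<eta> + 2" for x e
proof -
  have "e < L" using that less_L by linarith
  then have "(2::int) ^ e < 2 ^ L" by simp
  with that show ?thesis unfolding bits_le_iff by linarith
qed

lemma bits_le_L_nat: "bits (int x) \<le> L" if "x \<le> N \<or> x \<le> m" for x
proof (rule bits_le_L[of _ w])
  have "int x \<le> int (2 ^ w)" using le_w[OF that] by (simp only: of_nat_le_iff)
  then show "\<bar>int x\<bar> \<le> 2 ^ w" by simp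
qed simp

abbreviation vec :: "nat \<Rightarrow> nat \<Rightarrow> int" where
  "vec \<equiv> vertex_vec q m B"

lemma vec_bound: "\<bar>vec u r\<bar> \<le> int q * 2 ^ \<eta>"
proof -
  have "\<bar>vec u r\<bar> \<le> (\<Sum>j<q. \<bar>of_bool (bit u j) * B ((u div 2 ^ q * q + j) * m + r)\<bar>)"
    unfolding vertex_vec_def by (rule sum_abs)
  also have "\<dots> \<le> (\<Sum>j<q. 2 ^ \<eta>)"
    using B by (intro sum_mono) auto
  finally show ?thesis by simp
qed

text \<open>The two products contribute \<open>2 * k + 1\<close> and 3, and
  \<open>2 * k + 4 \<le> 4 * k\<close> says exactly that \<open>k\<close> is at least 2.\<close>

lemma edge_term_bound:
  assumes "\<bar>b\<bar> \<le> Y" "\<bar>c\<bar> \<le> Y" "\<bar>x\<bar> \<le> Y"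
  shows "\<bar>edge_term (int k) x b c\<bar> \<le> 4 * int k * Y\<^sup>2"
proof -
  have Y: "0 \<le> Y" using assms by linarith
  have *: "\<bar>y * z\<bar> \<le> a * Y\<^sup>2" if "\<bar>y\<bar> \<le> Y" "\<bar>z\<bar> \<le> a * Y" for y z a :: int
  proof -
    have "\<bar>y\<bar> * \<bar>z\<bar> \<le> Y * (a * Y)" using that Y by (intro mult_mono) auto
    then show ?thesis by (simp add: abs_mult power2_eq_square algebra_simps)
  qed
  have "\<bar>2 * (int k - 1) * c\<bar> \<le> 2 * (int k - 1) * Y"
    using assms k by (simp add: abs_mult)
  then have "\<bar>2 * (int k - 1) * c + b - 2 * x\<bar> \<le> (2 * int k + 1) * Y"
    using assms by (simp add: algebra_simps)
  then have "\<bar>b * (2 * (int k - 1) * c + b - 2 * x)\<bar> \<le> (2 * int k + 1) * Y\<^sup>2"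
    using assms by (intro *)
  moreover have "\<bar>c * (c - 2 * x)\<bar> \<le> 3 * Y\<^sup>2"
    using assms by (intro *) auto
  moreover have "(2 * int k + 1) * Y\<^sup>2 + 3 * Y\<^sup>2 \<le> 4 * int k * Y\<^sup>2"
    using k mult_right_mono[of "2 * int k + 4" "4 * int k" "Y\<^sup>2"] by (simp add: algebra_simps)
  ultimately show ?thesis unfolding edge_term_def by linarith
qed

lemma t_bound: "\<bar>t r\<bar> \<le> int q * 2 ^ \<eta>"
proof -
  have "(2::int) ^ \<eta> \<le> int q * 2 ^ \<eta>" using q_pos by simp
  with t[of r] show ?thesis by linarith
qed

text \<open>Prefixes \<open>l \<le> m\<close> are included because the program accumulates the sum
  in a cell whose length has to be controlled after every summand.\<close>

lemma edge_sum_bound: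
  assumes "l \<le> m"
  shows "\<bar>\<Sum>r<l. edge_term (int k) (t r) (vec u r) (vec v r)\<bar>
    \<le> 4 * int m * int k * (int q * 2 ^ \<eta>)\<^sup>2"
proof -
  have "\<bar>\<Sum>r<l. edge_term (int k) (t r) (vec u r) (vec v r)\<bar>
      \<le> (\<Sum>r<l. \<bar>edge_term (int k) (t r) (vec u r) (vec v r)\<bar>)"
    by (rule sum_abs)
  also have "\<dots> \<le> (\<Sum>r<l. 4 * int k * (int q * 2 ^ \<eta>)\<^sup>2)"
    by (intro sum_mono edge_term_bound vec_bound t_bound)
  also have "\<dots> = int l * (4 * int k * (int q * 2 ^ \<eta>)\<^sup>2)"
    by simp
  also have "\<dots> \<le> int m * (4 * int k * (int q * 2 ^ \<eta>)\<^sup>2)"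
    using assms by (intro mult_right_mono) auto
  finally show ?thesis by (simp add: algebra_simps)
qed

lemma int_le_w: "int x \<le> 2 ^ w" if "x \<le> N \<or> x \<le> m" for x
  using le_w[OF that] by (metis of_nat_le_iff of_nat_numeral of_nat_power)

lemma q_le_w: "int q \<le> 2 ^ w" and k_le_w: "int k \<le> 2 ^ w" and int_m_le_w: "int m \<le> 2 ^ w"
  using int_le_w q_le_M M_le_N k_le_N by auto

lemma bits_edge_sum:
  assumes "l \<le> m"
  shows "bits (\<Sum>r<l. edge_term (int k) (t r) (vec u r) (vec v r)) \<le> L"
proof (rule bits_le_L)
  have "\<bar>\<Sum>r<l. edge_term (int k) (t r) (vec u r) (vec v r)\<bar>
    \<le> 4 * int m * int k * (int q * 2 ^ \<eta>)\<^sup>2" by (rule edge_sum_bound[OF assms])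
  \<comment> \<open>One factor \<open>2 ^ w\<close> each for \<open>m\<close> and \<open>k\<close>
    and two for the square of \<open>q\<close> give the exponent
    \<open>4 * w + 2 * \<eta> + 2\<close>.\<close>
  also have "\<dots> \<le> 4 * 2 ^ w * 2 ^ w * (2 ^ w * 2 ^ \<eta>)\<^sup>2"
    using q_le_w k_le_w int_m_le_w by (intro mult_mono power_mono) auto
  also have "\<dots> = 2 ^ (4 * w + 2 * \<eta> + 2)"
    by (simp add: power_add power_mult power2_eq_square eval_nat_numeral)
  finally show "\<bar>\<Sum>r<l. edge_term (int k) (t r) (vec u r) (vec v r)\<bar> \<le> 2 ^ (4 * w + 2 * \<eta> + 2)" .
qed simp

lemma bits_vec: "bits (vec u r) \<le> L"
proof (rule bits_le_L)
  have "\<bar>vec u r\<bar> \<le> int q * 2 ^ \<eta>" by (rule vec_bound)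
  also have "\<dots> \<le> 2 ^ w * 2 ^ \<eta>" using q_le_w by simp
  finally show "\<bar>vec u r\<bar> \<le> 2 ^ (w + \<eta>)" by (simp add: power_add)
qed simp

lemma bits_den: "bits ((int k - 1) * (int q * int q)) \<le> L"
proof (rule bits_le_L)
  have "\<bar>(int k - 1) * (int q * int q)\<bar> \<le> 2 ^ w * (2 ^ w * 2 ^ w)"
    unfolding abs_mult using q_le_w k_le_w k by (intro mult_mono) (linarith | simp)+
  then show "\<bar>(int k - 1) * (int q * int q)\<bar> \<le> 2 ^ (w + (w + w))" by (simp add: power_add)
qed simp

lemma target_sum_bound: "l \<le> m \<Longrightarrow> \<bar>\<Sum>r<l. t r * t r\<bar> \<le> 2 ^ (w + (\<eta> + \<eta>))"
proof -
  assume "l \<le> m"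
  have "\<bar>\<Sum>r<l. t r * t r\<bar> \<le> (\<Sum>r<l. \<bar>t r * t r\<bar>)" by (rule sum_abs)
  also have "\<dots> \<le> (\<Sum>r<l. 2 ^ \<eta> * 2 ^ \<eta>)"
    unfolding abs_mult using t by (intro sum_mono mult_mono) auto
  also have "\<dots> = int l * (2 ^ \<eta> * 2 ^ \<eta>)" by simp
  also have "\<dots> \<le> 2 ^ w * (2 ^ \<eta> * 2 ^ \<eta>)"
    using \<open>l \<le> m\<close> int_m_le_w by (intro mult_right_mono) auto
  finally show ?thesis by (simp add: power_add)
qed

lemma bits_target_sum: "l \<le> m \<Longrightarrow> bits (\<Sum>r<l. t r * t r) \<le> L"
  by (rule bits_le_L[OF target_sum_bound]) auto

section \<open>Correctness and cost of the loops\<close>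

abbreviation triple_main :: "(mem \<Rightarrow> bool) \<Rightarrow> com \<Rightarrow> (mem \<Rightarrow> bool) \<Rightarrow> nat \<Rightarrow> bool" where
  "triple_main \<equiv> triple w (10 * \<eta>) (- {0})"

text \<open>Data that the later loops leave alone. The clause \<open>s 0 = h\<close> keeps track of
  array 0, about which \<open>fits (- {0})\<close> is silent.\<close>

definition env :: "mem \<Rightarrow> bool" where
  "env s \<longleftrightarrow> s 0 = h \<and> s 1 = B \<and> s 2 = t \<and> s 8 0 = int k \<and> s 9 0 = int m \<and> s 10 0 = int q
     \<and> s 11 0 = int M \<and> s 12 0 = int N"

lemma size_code:
  "triple_main
     (\<lambda>s. s 0 = h \<and> s 1 = B \<and> s 2 = t \<and> s 7 0 = int n \<and> s 8 0 = int k \<and> s 9 0 = int m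
        \<and> (\<forall>A\<in>{3,4,5,10,13,14,20}. s A = (\<lambda>_. 0)))
     size_code
     (\<lambda>s. env s \<and> (\<forall>A\<in>{3,4,5,13,14,20}. s A = (\<lambda>_. 0)))
     (3 * q + 3)"
proof -
  define Inv where "Inv i s \<longleftrightarrow> s 0 = h \<and> s 1 = B \<and> s 2 = t \<and> s 7 0 = int n \<and> s 8 0 = int k
     \<and> s 9 0 = int m \<and> (\<forall>A\<in>{3,4,5,13,14,20}. s A = (\<lambda>_. 0)) \<and> s 10 0 = int i \<and> s 11 0 = 2 ^ i"
    for i :: nat and s :: mem
  have "triple_main (Inv i) (Seq (assign_var 10 (Add (Var 10) (Num 1)))
      (assign_var 11 (Add (Var 11) (Var 11)))) (Inv (Suc i)) (1 + 1)" if "i < q" for i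
  \<comment> \<open>Between the two assignments the exponent is one ahead of its power of two; the
    assertion expresses this by putting the old exponent back.\<close>
  proof (rule triple_Seq[where Q = "\<lambda>s. Inv i (s(10 := (s 10)(0 := int i))) \<and> s 10 0 = int (Suc i)"])
    have "bits (1 + int i) \<le> L"
      using bits_le_L_nat[of "Suc i"] that q_le_M M_le_N by simp
    then show "triple_main (Inv i) (assign_var 10 (Add (Var 10) (Num 1)))
        (\<lambda>s. Inv i (s(10 := (s 10)(0 := int i))) \<and> s 10 0 = int (Suc i)) 1"
      by (intro triple_Assign) (auto simp: pair_cost_def Inv_def add.commute)
  next
    have "(2::nat) ^ Suc i \<le> M" unfolding M using that by (intro power_increasing) auto
    then have "bits (int (2 ^ Suc i)) \<le> L"
      using bits_le_L_nat[of "2 ^ Suc i"] M_le_N by simp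
    then show "triple_main (\<lambda>s. Inv i (s(10 := (s 10)(0 := int i))) \<and> s 10 0 = int (Suc i))
        (assign_var 11 (Add (Var 11) (Var 11))) (Inv (Suc i)) 1"
      by (intro triple_Assign) (auto simp: pair_cost_def Inv_def)
  qed
  then have loop: "triple_main (Inv 0)
      (WhileLess (Mul (Var 10) (Var 8)) (Var 7) (Seq (assign_var 10 (Add (Var 10) (Num 1)))
      (assign_var 11 (Add (Var 11) (Var 11))))) (Inv q) (q * ((1 + 1) + 1) + 1)"
  proof (rule triple_While)
    fix i s assume "Inv i s"
    then show "val s (Mul (Var 10) (Var 8)) < val s (Var 7) \<longleftrightarrow> i < q"
      using less_q[of i] by (auto simp: Inv_def simp flip: of_nat_mult)
  qed (auto simp: pair_cost_def)
  have init: "triple_main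
     (\<lambda>s. s 0 = h \<and> s 1 = B \<and> s 2 = t \<and> s 7 0 = int n \<and> s 8 0 = int k \<and> s 9 0 = int m
        \<and> (\<forall>A\<in>{3,4,5,10,13,14,20}. s A = (\<lambda>_. 0)))
     (assign_var 11 (Num 1)) (Inv 0) 1"
    using bits_le_L_nat[of 1] m by (intro triple_Assign) (auto simp: pair_cost_def Inv_def)
  have final: "triple_main (Inv q) (assign_var 12 (Mul (Var 8) (Var 11)))
     (\<lambda>s. env s \<and> (\<forall>A\<in>{3,4,5,13,14,20}. s A = (\<lambda>_. 0))) 1"
    using bits_le_L_nat[of N]
    by (intro triple_Assign) (auto simp: pair_cost_def Inv_def env_def int_N int_M)
  show ?thesis
    unfolding size_code_def
    by (rule triple_weaken[OF triple_Seq[OF init triple_Seq[OF loop final]]]) auto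
qed

abbreviation "blocks \<equiv> \<lambda>a. int (a div M)"

lemma block_code:
  "triple_main (\<lambda>s. env s \<and> (\<forall>A\<in>{3,4,5,13,14,20}. s A = (\<lambda>_. 0)))
     block_code
     (\<lambda>s. env s \<and> (\<forall>A\<in>{3,4,5,13,20}. s A = (\<lambda>_. 0)) \<and> s 14 = fill N blocks)
     (k * (M * 3 + 4) + 2)"
proof -
  define Inv where "Inv l s \<longleftrightarrow> env s \<and> (\<forall>A\<in>{3,4,5,13,20}. s A = (\<lambda>_. 0)) \<and> s 14 = fill l blocks"
    for l :: nat and s :: mem
  note defs = Inv_def env_def
  have inner: "triple_main (\<lambda>s. (Inv (i * M + x) s \<and> s 15 0 = int i) \<and> s 16 0 = int x)
      (Assign 14 (block_vertex (Var 16)) (Var 15))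
      (\<lambda>s. (Inv (i * M + Suc x) s \<and> s 15 0 = int i) \<and> s 16 0 = int x) 1"
    if "i < k" "x < M" for i x
  proof -
    have "int i = blocks (i * M + x)" using that by simp
    then have "(fill (i * M + x) blocks)(i * M + x := int i) = fill (i * M + Suc x) blocks"
      using fill_update[of "i * M + x" blocks] by simp
    moreover have "bits (int i) \<le> L" using bits_le_L_nat[of i] that k_le_N by simp
    ultimately show ?thesis
      by (intro triple_Assign) (auto simp: pair_cost_def defs simp flip: of_nat_mult of_nat_add)
  qed
  have outer: "triple_main (\<lambda>s. Inv (i * M) s \<and> s 15 0 = int i)
      (for_loop 16 11 (Assign 14 (block_vertex (Var 16)) (Var 15)))
      (\<lambda>s. Inv (Suc i * M) s \<and> s 15 0 = int i) (M * 3 + 2)" if "i < k" for i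
    by (rule triple_for_weaken[where Inv = "\<lambda>x s. Inv (i * M + x) s \<and> s 15 0 = int i" and b = M,
          OF _ _ _ _ _ _ _ _ inner[OF that]])
      (use bits_le_L_nat[of M] M_le_N in \<open>auto simp: defs add.commute\<close>)
  show ?thesis
    unfolding block_code_def
    by (rule triple_for_weaken[where Inv = "\<lambda>i. Inv (i * M)" and b = k, OF _ _ _ _ _ _ _ _ outer])
      (use bits_le_L_nat[of k] k_le_N in \<open>auto simp: defs algebra_simps M_mult_k\<close>)
qed

abbreviation "table \<equiv> \<lambda>a. vec (a div m) (a mod m)"

lemma vec_block_start: "vec (i * M) r = 0"
proof -
  have "\<not> bit (i * M) j" if "j < q" for j
    using that by (simp add: M mult.commute[of i] flip: push_bit_eq_mult) (simp add: bit_push_bit_iff)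
  then show ?thesis by (simp add: vertex_vec_def)
qed

lemma bit_in_block: "bit (i * M + y) l \<longleftrightarrow> bit y l" if "y < M" "l < q" for y :: nat
proof -
  have "take_bit q (i * M + y) = y" using that by (simp add: take_bit_eq_mod M)
  then show ?thesis using that by (metis bit_take_bit_iff)
qed

text \<open>Bit \<open>j\<close> of \<open>x\<close> is free, so adding \<open>2 ^ j\<close> causes
  no carry and is a bitwise disjunction.\<close>

lemma bit_add_top: "bit (2 ^ j + x) l \<longleftrightarrow> l = j \<or> bit x l" if "x < 2 ^ j" for x :: nat
proof -
  have "2 ^ j + x = push_bit j 1 + x" by (simp add: push_bit_eq_mult)
  moreover have "\<not> bit x l" if "j \<le> l" for l
    using \<open>x < 2 ^ j\<close> that
    by (metis bit_iff_odd div_less even_zero less_le_trans one_less_numeral_iff power_increasing_iff semiring_norm(76))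
  then have "push_bit j 1 + x = or (push_bit j 1) x"
    by (intro disjunctive_add) (auto simp: bit_exp_iff)
  ultimately show ?thesis
    by (auto simp: bit_or_iff bit_exp_iff)
qed

text \<open>The recurrence that fills the table: both vertices lie in block \<open>i\<close>, since
  \<open>2 ^ j + x < M\<close>, and their bits differ at \<open>j\<close> only.\<close>

lemma vec_top:
  assumes "j < q" "x < 2 ^ j"
  shows "vec (i * M + (2 ^ j + x)) r = vec (i * M + x) r + B ((i * q + j) * m + r)"
proof -
  have "2 ^ j + x < 2 ^ Suc j" using assms by simp
  also have "(2::nat) ^ Suc j \<le> M" unfolding M using assms by (intro power_increasing) auto
  finally have y: "2 ^ j + x < M" "x < M" by simp_all
  have "\<not> bit x j" using bit_add_top[OF assms(2), of j] assms(2)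
    by (simp add: bit_iff_odd)
  then have "of_bool (l = j \<or> bit x l) * b = of_bool (bit x l) * b + (if l = j then b else 0)" for l and b :: int
    by auto
  with y show ?thesis
    using assms by (simp add: vertex_vec_def bit_in_block bit_add_top sum.distrib flip: M)
qed

text \<open>Round \<open>j\<close> of a block produces its vertices from \<open>2 ^ j\<close> to
  \<open>2 ^ Suc j - 1\<close>, so the four nested loops write array 13 in increasing order and a
  single prefix length records the progress.\<close>

lemma table_code:
  "triple_main (\<lambda>s. env s \<and> (\<forall>A\<in>{3,4,5,13,20}. s A = (\<lambda>_. 0)) \<and> s 14 = fill N blocks)
     table_code
     (\<lambda>s. env s \<and> (\<forall>A\<in>{3,4,5,20}. s A = (\<lambda>_. 0)) \<and> s 14 = fill N blocks
        \<and> s 13 = fill (N * m) table)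
     (k * (q * (M * (m * 3 + 4) + 5) + 5) + 2)"
proof -
  define Inv where "Inv l s \<longleftrightarrow> env s \<and> (\<forall>A\<in>{3,4,5,20}. s A = (\<lambda>_. 0)) \<and> s 14 = fill N blocks
     \<and> s 13 = fill l table" for l :: nat and s :: mem
  note defs = Inv_def env_def
  have entry: "triple_main
      (\<lambda>s. (Inv ((i * M + (2 ^ j + x)) * m + r) s \<and> s 15 0 = int i \<and> s 16 0 = int j \<and> s 17 0 = int x
         \<and> s 19 0 = int (2 ^ j)) \<and> s 18 0 = int r)
      (Assign 13 (row_entry (block_vertex (Add (Var 19) (Var 17))))
        (Add (Cell 13 (row_entry (block_vertex (Var 17))))
           (Cell 1 (row_entry (Add (Mul (Var 15) (Var 10)) (Var 16))))))
      (\<lambda>s. (Inv ((i * M + (2 ^ j + x)) * m + Suc r) s \<and> s 15 0 = int i \<and> s 16 0 = int j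
         \<and> s 17 0 = int x \<and> s 19 0 = int (2 ^ j)) \<and> s 18 0 = int r) 1"
    if "i < k" "j < q" "x < 2 ^ j" "r < m" for i j x r
  proof (rule triple_Assign)
    let ?l = "(i * M + (2 ^ j + x)) * m + r" and ?p = "(i * M + x) * m + r"
    let ?a = "row_entry (block_vertex (Add (Var 19) (Var 17)))"
    let ?e = "Add (Cell 13 (row_entry (block_vertex (Var 17))))
           (Cell 1 (row_entry (Add (Mul (Var 15) (Var 10)) (Var 16))))"
    fix s assume s: "(Inv ?l s \<and> s 15 0 = int i \<and> s 16 0 = int j \<and> s 17 0 = int x
         \<and> s 19 0 = int (2 ^ j)) \<and> s 18 0 = int r"
    have "val s ?a = int ?l" "val s (row_entry (block_vertex (Var 17))) = int ?p"
      "val s (row_entry (Add (Mul (Var 15) (Var 10)) (Var 16))) = int ((i * q + j) * m + r)"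
      using s by (simp_all add: defs)
    \<comment> \<open>The entry that is read precedes the one that is written, hence belongs to the
      prefix already filled.\<close>
    moreover have "?p < ?l" using m by simp
    ultimately have a: "nat (val s ?a) = ?l" and e: "val s ?e = table ?l"
      using s that m vec_top[OF that(2,3), of i r] by (simp_all add: defs fill_def del: of_nat_add of_nat_mult)
    show "((Inv ((i * M + (2 ^ j + x)) * m + Suc r) (s(13 := (s 13)(nat (val s ?a) := val s ?e)))
         \<and> (s(13 := (s 13)(nat (val s ?a) := val s ?e))) 15 0 = int i
         \<and> (s(13 := (s 13)(nat (val s ?a) := val s ?e))) 16 0 = int j
         \<and> (s(13 := (s 13)(nat (val s ?a) := val s ?e))) 17 0 = int x
         \<and> (s(13 := (s 13)(nat (val s ?a) := val s ?e))) 19 0 = int (2 ^ j))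
         \<and> (s(13 := (s 13)(nat (val s ?a) := val s ?e))) 18 0 = int r)
         \<and> (13 \<in> - {0::nat} \<longrightarrow> bits (val s ?e) \<le> L)"
      unfolding a e using s fill_update[of ?l table] bits_vec by (simp add: defs)
  qed (auto simp: pair_cost_def)
  have row: "triple_main
      (\<lambda>s. (Inv ((i * M + (2 ^ j + x)) * m) s \<and> s 15 0 = int i \<and> s 16 0 = int j
         \<and> s 19 0 = int (2 ^ j)) \<and> s 17 0 = int x)
      (for_loop 18 9 (Assign 13 (row_entry (block_vertex (Add (Var 19) (Var 17))))
        (Add (Cell 13 (row_entry (block_vertex (Var 17))))
           (Cell 1 (row_entry (Add (Mul (Var 15) (Var 10)) (Var 16)))))))
      (\<lambda>s. (Inv ((i * M + (2 ^ j + Suc x)) * m) s \<and> s 15 0 = int i \<and> s 16 0 = int j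
         \<and> s 19 0 = int (2 ^ j)) \<and> s 17 0 = int x) (m * 3 + 2)"
    if "i < k" "j < q" "x < 2 ^ j" for i j x
    by (rule triple_for_weaken[where b = m and
          Inv = "\<lambda>r s. Inv ((i * M + (2 ^ j + x)) * m + r) s \<and> s 15 0 = int i \<and> s 16 0 = int j
            \<and> s 17 0 = int x \<and> s 19 0 = int (2 ^ j)",
          OF _ _ _ _ _ _ _ _ entry[OF that]])
      (use bits_le_L_nat[of m] in \<open>auto simp: defs algebra_simps\<close>)
  have rows: "triple_main
      (\<lambda>s. (Inv ((i * M + 2 ^ j) * m) s \<and> s 15 0 = int i \<and> s 19 0 = int (2 ^ j)) \<and> s 16 0 = int j)
      (for_loop 17 19 (for_loop 18 9 (Assign 13 (row_entry (block_vertex (Add (Var 19) (Var 17))))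
        (Add (Cell 13 (row_entry (block_vertex (Var 17))))
           (Cell 1 (row_entry (Add (Mul (Var 15) (Var 10)) (Var 16))))))))
      (\<lambda>s. (Inv ((i * M + 2 ^ Suc j) * m) s \<and> s 15 0 = int i \<and> s 19 0 = int (2 ^ j)) \<and> s 16 0 = int j)
      (2 ^ j * (m * 3 + 4) + 2)"
    if "i < k" "j < q" for i j
  proof -
    have "(2::nat) ^ j \<le> M" unfolding M using that by (intro power_increasing) auto
    then have "bits (int (2 ^ j)) \<le> L" using bits_le_L_nat[of "2 ^ j"] M_le_N by simp
    then show ?thesis
      by (intro triple_for_weaken[where b = "2 ^ j" and
            Inv = "\<lambda>x s. Inv ((i * M + (2 ^ j + x)) * m) s \<and> s 15 0 = int i \<and> s 16 0 = int j
               \<and> s 19 0 = int (2 ^ j)",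
            OF _ _ _ _ _ _ _ _ row[OF that]])
        (auto simp: defs distrib_left simp flip: mult_2)
  qed
  have double: "triple_main
      (\<lambda>s. (Inv ((i * M + 2 ^ Suc j) * m) s \<and> s 15 0 = int i \<and> s 19 0 = int (2 ^ j)) \<and> s 16 0 = int j)
      (assign_var 19 (Add (Var 19) (Var 19)))
      (\<lambda>s. (Inv ((i * M + 2 ^ Suc j) * m) s \<and> s 15 0 = int i \<and> s 19 0 = int (2 ^ Suc j))
         \<and> s 16 0 = int j) 1"
    if "j < q" for i j
  proof -
    have "(2::nat) ^ Suc j \<le> M" unfolding M using that by (intro power_increasing) auto
    then have "bits (int (2 ^ Suc j)) \<le> L" using bits_le_L_nat[of "2 ^ Suc j"] M_le_N by simp
    then show ?thesis by (intro triple_Assign) (auto simp: pair_cost_def defs)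
  qed
  have step: "triple_main
      (\<lambda>s. (Inv ((i * M + 2 ^ j) * m) s \<and> s 15 0 = int i \<and> s 19 0 = int (2 ^ j)) \<and> s 16 0 = int j)
      (Seq (for_loop 17 19 (for_loop 18 9
           (Assign 13 (row_entry (block_vertex (Add (Var 19) (Var 17))))
              (Add (Cell 13 (row_entry (block_vertex (Var 17))))
                 (Cell 1 (row_entry (Add (Mul (Var 15) (Var 10)) (Var 16))))))))
        (assign_var 19 (Add (Var 19) (Var 19))))
      (\<lambda>s. (Inv ((i * M + 2 ^ Suc j) * m) s \<and> s 15 0 = int i \<and> s 19 0 = int (2 ^ Suc j))
         \<and> s 16 0 = int j) (M * (m * 3 + 4) + 3)"
    if "i < k" "j < q" for i j
  proof (rule triple_weaken[OF triple_Seq[OF rows[OF that] double[OF that(2)]]])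
    have "(2::nat) ^ j \<le> M" unfolding M using that by (intro power_increasing) auto
    then show "2 ^ j * (m * 3 + 4) + 2 + 1 \<le> M * (m * 3 + 4) + 3"
      using mult_le_mono1 by simp
  qed
  have start: "triple_main (\<lambda>s. Inv (i * M * m) s \<and> s 15 0 = int i) (assign_var 19 (Num 1))
      (\<lambda>s. (Inv ((i * M + 2 ^ 0) * m) s \<and> s 19 0 = int (2 ^ 0)) \<and> s 15 0 = int i) 1" for i
  proof -
    \<comment> \<open>No round writes vertex 0 of the block: its vector is zero, like the untouched
      memory.\<close>
    have "fill (i * M * m) table = fill ((i * M + 1) * m) table"
    proof (rule fill_extend)
      fix a assume a: "i * M * m \<le> a" "a < (i * M + 1) * m"
      then have "a div m = i * M" by (intro div_nat_eqI) (simp_all add: algebra_simps)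
      then show "table a = 0" by (simp add: vec_block_start)
    qed simp
    then show ?thesis
      using bits_le_L_nat[of 1] m
      by (intro triple_Assign) (auto simp: pair_cost_def defs)
  qed
  have loop: "triple_main (\<lambda>s. (Inv ((i * M + 2 ^ 0) * m) s \<and> s 19 0 = int (2 ^ 0)) \<and> s 15 0 = int i)
      (for_loop 16 10 (Seq (for_loop 17 19 (for_loop 18 9
           (Assign 13 (row_entry (block_vertex (Add (Var 19) (Var 17))))
              (Add (Cell 13 (row_entry (block_vertex (Var 17))))
                 (Cell 1 (row_entry (Add (Mul (Var 15) (Var 10)) (Var 16))))))))
        (assign_var 19 (Add (Var 19) (Var 19)))))
      (\<lambda>s. Inv (Suc i * M * m) s \<and> s 15 0 = int i) (q * (M * (m * 3 + 4) + 5) + 2)"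
    if "i < k" for i
    by (rule triple_for_weaken[where b = q and
          Inv = "\<lambda>j s. Inv ((i * M + 2 ^ j) * m) s \<and> s 15 0 = int i \<and> s 19 0 = int (2 ^ j)",
          OF _ _ _ _ _ _ _ _ step[OF that]])
      (use bits_le_L_nat[of q] q_le_M M_le_N in \<open>auto simp: defs algebra_simps simp flip: M\<close>)
  show ?thesis
    unfolding table_code_def
    by (rule triple_for_weaken[where Inv = "\<lambda>i. Inv (i * M * m)" and b = k,
          OF _ _ _ _ _ _ _ _ triple_Seq[OF start loop]])
      (use bits_le_L_nat[of k] k_le_N in \<open>auto simp: defs algebra_simps M_mult_k\<close>)
qed

abbreviation "adjacency \<equiv> \<lambda>a. of_bool (a div N div M \<noteq> a mod N div M) :: int"

abbreviation "numerators \<equiv> \<lambda>a. edge_num k q m B t (a div N) (a mod N)"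

abbreviation "denominator \<equiv> (int k - 1) * (int q * int q)"

lemma edge_code:
  "triple_main (\<lambda>s. env s \<and> (\<forall>A\<in>{3,4,5,20}. s A = (\<lambda>_. 0)) \<and> s 14 = fill N blocks
        \<and> s 13 = fill (N * m) table)
     edge_code
     (\<lambda>s. env s \<and> s 20 = (\<lambda>_. 0) \<and> s 3 = fill (N * N) adjacency
        \<and> s 4 = fill (N * N) numerators \<and> s 5 = fill (N * N) (\<lambda>_. denominator))
     (N * (N * (m * 3 + 7) + 4) + 2)"
proof -
  define Inv where "Inv a3 a4 a5 s \<longleftrightarrow> env s \<and> s 20 = (\<lambda>_. 0) \<and> s 14 = fill N blocks
     \<and> s 13 = fill (N * m) table \<and> s 3 = a3 \<and> s 4 = a4 \<and> s 5 = a5"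
    for a3 a4 a5 :: "nat \<Rightarrow> int" and s :: mem
  note defs = Inv_def env_def
  let ?den = "\<lambda>_. denominator"
  define F where "F l = Inv (fill l adjacency) (fill l numerators) (fill l ?den)" for l
  let ?entry = "\<lambda>u v r. edge_term (int k) (t r) (vec u r) (vec v r)"
  let ?row = "Assign 4 edge_index (Add (Cell 4 edge_index)
           (edge_expr (Var 8) (Cell 2 (Var 18)) (Cell 13 (row_entry (Var 15)))
              (Cell 13 (row_entry (Var 16)))))"
  let ?adj = "IfLess (Num 0) (Mul (Sub (Cell 14 (Var 15)) (Cell 14 (Var 16)))
                             (Sub (Cell 14 (Var 15)) (Cell 14 (Var 16))))
           (Assign 3 edge_index (Num 1)) Skip"
  have index: "u * N + v < N * N" if "u < N" "v < N" for u v
  proof -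
    have "u * N + v < Suc u * N" using that by simp
    also have "\<dots> \<le> N * N" using that by (intro mult_le_mono1) simp
    finally show ?thesis .
  qed
  have entry_index: "u * m + r < N * m" if "u < N" "r < m" for u r
  proof -
    have "u * m + r < Suc u * m" using that by simp
    also have "\<dots> \<le> N * m" using that by (intro mult_le_mono1) simp
    finally show ?thesis .
  qed
  have den: "triple_main (\<lambda>s. (F (u * N + v) s \<and> s 15 0 = int u) \<and> s 16 0 = int v)
      (Assign 5 edge_index (Mul (Sub (Var 8) (Num 1)) (Mul (Var 10) (Var 10))))
      (\<lambda>s. (Inv (fill (u * N + v) adjacency) (fill (u * N + v) numerators)
              (fill (Suc (u * N + v)) ?den) s \<and> s 15 0 = int u) \<and> s 16 0 = int v) 1" for u v
    using bits_den fill_update[of "u * N + v" ?den]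
    by (intro triple_Assign) (auto simp: pair_cost_def defs F_def simp flip: of_nat_mult of_nat_add)
  have adj: "triple_main
      (\<lambda>s. (Inv (fill (u * N + v) adjacency) (fill (u * N + v) numerators)
              (fill (Suc (u * N + v)) ?den) s \<and> s 15 0 = int u) \<and> s 16 0 = int v)
      ?adj
      (\<lambda>s. (Inv (fill (Suc (u * N + v)) adjacency) (fill (u * N + v) numerators)
              (fill (Suc (u * N + v)) ?den) s \<and> s 15 0 = int u) \<and> s 16 0 = int v) (1 + 1)"
    if "u < N" "v < N" for u v
  proof -
    let ?l = "u * N + v"
    have l: "?l div N = u" "?l mod N = v" using that by simp_all
    have upd: "(fill ?l adjacency)(?l := 1) = fill (Suc ?l) adjacency" if "u div M \<noteq> v div M"
      using fill_update[of ?l adjacency] that l by simp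
    \<comment> \<open>For two vertices of one block nothing is written, and the initial 0 is the
      correct entry.\<close>
    have ext: "fill ?l adjacency = fill (Suc ?l) adjacency" if "u div M = v div M"
      using that l by (intro fill_extend) (auto simp: not_less le_Suc_eq less_Suc_eq)
    have test: "val s (Num 0) < val s (Mul (Sub (Cell 14 (Var 15)) (Cell 14 (Var 16)))
          (Sub (Cell 14 (Var 15)) (Cell 14 (Var 16)))) \<longleftrightarrow> u div M \<noteq> v div M"
      if "s 14 = fill N blocks" "s 15 0 = int u" "s 16 0 = int v" for s
      using that \<open>u < N\<close> \<open>v < N\<close> by (auto simp: fill_def zero_less_mult_iff)
    show ?thesis
    proof (rule triple_If)
      show "triple_main (\<lambda>s. ((Inv (fill ?l adjacency) (fill ?l numerators) (fill (Suc ?l) ?den) s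
            \<and> s 15 0 = int u) \<and> s 16 0 = int v)
          \<and> val s (Num 0) < val s (Mul (Sub (Cell 14 (Var 15)) (Cell 14 (Var 16)))
              (Sub (Cell 14 (Var 15)) (Cell 14 (Var 16)))))
        (Assign 3 edge_index (Num 1))
        (\<lambda>s. (Inv (fill (Suc ?l) adjacency) (fill ?l numerators) (fill (Suc ?l) ?den) s
            \<and> s 15 0 = int u) \<and> s 16 0 = int v) 1"
      proof (rule triple_Assign)
        fix s assume s: "((Inv (fill ?l adjacency) (fill ?l numerators) (fill (Suc ?l) ?den) s
            \<and> s 15 0 = int u) \<and> s 16 0 = int v)
          \<and> val s (Num 0) < val s (Mul (Sub (Cell 14 (Var 15)) (Cell 14 (Var 16)))
              (Sub (Cell 14 (Var 15)) (Cell 14 (Var 16))))"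
        then have ne: "u div M \<noteq> v div M" using test[of s] unfolding Inv_def by blast
        have "nat (val s edge_index) = ?l"
          using s by (simp add: defs flip: of_nat_mult of_nat_add)
        then show "((Inv (fill (Suc ?l) adjacency) (fill ?l numerators) (fill (Suc ?l) ?den)
                (s(3 := (s 3)(nat (val s edge_index) := val s (Num 1))))
            \<and> (s(3 := (s 3)(nat (val s edge_index) := val s (Num 1)))) 15 0 = int u)
            \<and> (s(3 := (s 3)(nat (val s edge_index) := val s (Num 1)))) 16 0 = int v)
            \<and> (3 \<in> - {0::nat} \<longrightarrow> bits (val s (Num 1)) \<le> L)"
          using s upd[OF ne] bits_le_L_nat[of 1] m by (simp add: defs)
      qed (auto simp: pair_cost_def)
      show "triple_main (\<lambda>s. ((Inv (fill ?l adjacency) (fill ?l numerators) (fill (Suc ?l) ?den) s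
            \<and> s 15 0 = int u) \<and> s 16 0 = int v)
          \<and> \<not> val s (Num 0) < val s (Mul (Sub (Cell 14 (Var 15)) (Cell 14 (Var 16)))
              (Sub (Cell 14 (Var 15)) (Cell 14 (Var 16)))))
        Skip
        (\<lambda>s. (Inv (fill (Suc ?l) adjacency) (fill ?l numerators) (fill (Suc ?l) ?den) s
            \<and> s 15 0 = int u) \<and> s 16 0 = int v) 1"
      proof (rule triple_Skip)
        fix s assume s: "((Inv (fill ?l adjacency) (fill ?l numerators) (fill (Suc ?l) ?den) s
            \<and> s 15 0 = int u) \<and> s 16 0 = int v)
          \<and> \<not> val s (Num 0) < val s (Mul (Sub (Cell 14 (Var 15)) (Cell 14 (Var 16)))
              (Sub (Cell 14 (Var 15)) (Cell 14 (Var 16))))"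
        then have "u div M = v div M" using test[of s] unfolding Inv_def by blast
        with s ext show "(Inv (fill (Suc ?l) adjacency) (fill ?l numerators) (fill (Suc ?l) ?den) s
            \<and> s 15 0 = int u) \<and> s 16 0 = int v" by simp
      qed
    qed (auto simp: pair_cost_def)
  qed
  \<comment> \<open>Cell \<open>u * N + v\<close> lies just beyond the filled prefix and holds the
    sum over the first \<open>r\<close> coordinates; it starts at 0 and joins the prefix at
    \<open>r = m\<close>.\<close>
  define R where "R u v r s \<longleftrightarrow> Inv (fill (Suc (u * N + v)) adjacency)
      ((fill (u * N + v) numerators)(u * N + v := \<Sum>r'<r. ?entry u v r'))
      (fill (Suc (u * N + v)) ?den) s \<and> s 15 0 = int u \<and> s 16 0 = int v" for u v r :: nat and s :: mem
  have entry: "triple_main (\<lambda>s. R u v r s \<and> s 18 0 = int r) ?row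
      (\<lambda>s. R u v (Suc r) s \<and> s 18 0 = int r) 1"
    if "u < N" "v < N" "r < m" for u v r
  proof (rule triple_Assign)
    let ?l = "u * N + v"
    let ?e = "Add (Cell 4 edge_index)
           (edge_expr (Var 8) (Cell 2 (Var 18)) (Cell 13 (row_entry (Var 15)))
              (Cell 13 (row_entry (Var 16))))"
    fix s assume s: "R u v r s \<and> s 18 0 = int r"
    have "val s edge_index = int ?l"
      "val s (row_entry (Var 15)) = int (u * m + r)" "val s (row_entry (Var 16)) = int (v * m + r)"
      using s by (simp_all add: defs R_def)
    then have l: "nat (val s edge_index) = ?l"
      and c: "val s (Cell 13 (row_entry (Var 15))) = vec u r"
        "val s (Cell 13 (row_entry (Var 16))) = vec v r"
        "val s (Cell 4 edge_index) = (\<Sum>r'<r. ?entry u v r')"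
      using s that entry_index
      by (simp_all add: defs R_def fill_def del: of_nat_add of_nat_mult)
    have e: "val s ?e = (\<Sum>r'<Suc r. ?entry u v r')"
      using s c by (simp add: edge_expr_def edge_term_def defs R_def)
    show "(R u v (Suc r) (s(4 := (s 4)(nat (val s edge_index) := val s ?e)))
        \<and> (s(4 := (s 4)(nat (val s edge_index) := val s ?e))) 18 0 = int r)
        \<and> (4 \<in> - {0::nat} \<longrightarrow> bits (val s ?e) \<le> L)"
      unfolding l e using s bits_edge_sum[of "Suc r" u v] that(3)
      by (simp add: defs R_def)
  qed (auto simp: pair_cost_def edge_expr_def)
  have row: "triple_main
      (\<lambda>s. (Inv (fill (Suc (u * N + v)) adjacency) (fill (u * N + v) numerators)
              (fill (Suc (u * N + v)) ?den) s \<and> s 15 0 = int u) \<and> s 16 0 = int v)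
      (for_loop 18 9 ?row)
      (\<lambda>s. (F (u * N + Suc v) s \<and> s 15 0 = int u) \<and> s 16 0 = int v) (m * 3 + 2)"
    if "u < N" "v < N" for u v
  proof (rule triple_for_weaken[where Inv = "R u v" and b = m, OF _ _ _ _ _ _ _ _ entry[OF that]])
    let ?l = "u * N + v"
    have "numerators ?l = (\<Sum>r'<m. ?entry u v r')" using that by (simp add: edge_num_def)
    then have "(fill ?l numerators)(?l := \<Sum>r'<m. ?entry u v r') = fill (Suc ?l) numerators"
      using fill_update[of ?l numerators] by simp
    then show "(F (u * N + Suc v) s \<and> s 15 0 = int u) \<and> s 16 0 = int v" if "R u v m s" for s
      using that by (simp add: R_def F_def)
    have "(fill ?l numerators)(?l := 0) = fill ?l numerators"
      by (auto simp: fill_def fun_eq_iff)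
    then show "R u v 0 s" if "(Inv (fill (Suc ?l) adjacency) (fill ?l numerators)
              (fill (Suc ?l) ?den) s \<and> s 15 0 = int u) \<and> s 16 0 = int v" for s
      using that by (simp add: R_def)
  qed (use bits_le_L_nat[of m] in \<open>auto simp: defs R_def\<close>)
  have rows: "triple_main (\<lambda>s. F (u * N) s \<and> s 15 0 = int u)
      (for_loop 16 12 (Seq
     (Assign 5 edge_index (Mul (Sub (Var 8) (Num 1)) (Mul (Var 10) (Var 10))))
     (Seq ?adj (for_loop 18 9 ?row))))
      (\<lambda>s. F (Suc u * N) s \<and> s 15 0 = int u) (N * (m * 3 + 7) + 2)"
    if "u < N" for u
    by (rule triple_for_weaken[where b = N and Inv = "\<lambda>v s. F (u * N + v) s \<and> s 15 0 = int u",
          OF _ _ _ _ _ _ _ _ triple_Seq[OF den triple_Seq[OF adj[OF that] row[OF that]]]])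
      (use bits_le_L_nat[of N] in \<open>auto simp: defs F_def algebra_simps\<close>)
  show ?thesis
    unfolding edge_code_def
    by (rule triple_for_weaken[where b = N and Inv = "\<lambda>u. F (u * N)",
          OF _ _ _ _ _ _ _ _ rows])
      (use bits_le_L_nat[of N] in \<open>auto simp: defs F_def algebra_simps\<close>)
qed

lemma target_code:
  "triple_main
     (\<lambda>s. env s \<and> s 20 = (\<lambda>_. 0) \<and> s 3 = fill (N * N) adjacency
        \<and> s 4 = fill (N * N) numerators \<and> s 5 = fill (N * N) (\<lambda>_. denominator))
     target_code
     (\<lambda>s. env s \<and> s 20 0 = (\<Sum>r<m. t r * t r) \<and> s 3 = fill (N * N) adjacency
        \<and> s 4 = fill (N * N) numerators \<and> s 5 = fill (N * N) (\<lambda>_. denominator))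
     (m * 3 + 2)"
proof -
  define Inv where "Inv r s \<longleftrightarrow> env s \<and> s 20 0 = (\<Sum>r'<r. t r' * t r') \<and> s 3 = fill (N * N) adjacency
        \<and> s 4 = fill (N * N) numerators \<and> s 5 = fill (N * N) (\<lambda>_. denominator)"
    for r :: nat and s :: mem
  note defs = Inv_def env_def
  have entry: "triple_main (\<lambda>s. Inv r s \<and> s 18 0 = int r)
      (assign_var 20 (Add (Var 20) (Mul (Cell 2 (Var 18)) (Cell 2 (Var 18)))))
      (\<lambda>s. Inv (Suc r) s \<and> s 18 0 = int r) 1" if "r < m" for r
    using bits_target_sum[of "Suc r"] that
    by (intro triple_Assign) (auto simp: pair_cost_def defs)
  show ?thesis
    unfolding target_code_def
    by (rule triple_for_weaken[where b = m and Inv = Inv, OF _ _ _ _ _ _ _ _ entry])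
      (use bits_le_L_nat[of m] in \<open>auto simp: defs\<close>)
qed

text \<open>The edge loops make \<open>m * N\<^sup>2\<close> innermost steps. The table takes about
  \<open>q * m * N\<close>, which \<open>q \<le> N\<close> absorbs, and lower terms are absorbed
  since \<open>m\<close> and \<open>N\<close> are positive. The five parts add up to 55.\<close>

lemma main_code:
  "triple_main
     (\<lambda>s. s 0 = h \<and> s 1 = B \<and> s 2 = t \<and> s 7 0 = int n \<and> s 8 0 = int k \<and> s 9 0 = int m
        \<and> (\<forall>A\<in>{3,4,5,10,13,14,20}. s A = (\<lambda>_. 0)))
     main_code
     (\<lambda>s. env s \<and> s 20 0 = (\<Sum>r<m. t r * t r) \<and> s 3 = fill (N * N) adjacency
        \<and> s 4 = fill (N * N) numerators \<and> s 5 = fill (N * N) (\<lambda>_. denominator))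
     (60 * (m * N\<^sup>2))"
proof -
  have N2: "N \<le> N\<^sup>2" using N_pos by (simp add: power2_eq_square)
  have "1 \<le> N\<^sup>2" using N_pos by simp
  have a: "x \<le> m * x" for x using m by simp
  note N1 = \<open>1 \<le> N\<^sup>2\<close> order_trans[OF N2 a] order_trans[OF \<open>1 \<le> N\<^sup>2\<close> a]
  have mN: "m \<le> m * N\<^sup>2" using N_pos by simp
  have "q \<le> N" using q_le_M M_le_N by simp
  then have size: "3 * q + 3 \<le> 6 * (m * N\<^sup>2)" using N1 by linarith
  have "k * (M * 3 + 4) + 2 = 3 * N + 4 * k + 2" by (simp add: N algebra_simps)
  then have block: "k * (M * 3 + 4) + 2 \<le> 9 * (m * N\<^sup>2)" using k_le_N N1 by linarith
  have "k * q \<le> N" using q_le_M by (simp add: N)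
  have "k * (q * (M * (m * 3 + 4) + 5) + 5) + 2 = q * (3 * (m * N) + 4 * N) + 5 * (k * q) + 5 * k + 2"
    by (simp add: N algebra_simps)
  also have "\<dots> \<le> N * (3 * (m * N) + 4 * N) + 5 * N + 5 * N + 2"
    using \<open>q \<le> N\<close> \<open>k * q \<le> N\<close> k_le_N by (intro add_mono mult_le_mono) auto
  also have "\<dots> = 3 * (m * N\<^sup>2) + 4 * N\<^sup>2 + 10 * N + 2" by (simp add: power2_eq_square algebra_simps)
  also have "\<dots> \<le> 19 * (m * N\<^sup>2)" using N1 a[of "N\<^sup>2"] by linarith
  finally have table: "k * (q * (M * (m * 3 + 4) + 5) + 5) + 2 \<le> 19 * (m * N\<^sup>2)" .
  have "N * (N * (m * 3 + 7) + 4) + 2 = 3 * (m * N\<^sup>2) + 7 * N\<^sup>2 + 4 * N + 2"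
    by (simp add: power2_eq_square algebra_simps)
  also have "\<dots> \<le> 16 * (m * N\<^sup>2)" using N1 a[of "N\<^sup>2"] by linarith
  finally have edge: "N * (N * (m * 3 + 7) + 4) + 2 \<le> 16 * (m * N\<^sup>2)" .
  have target: "m * 3 + 2 \<le> 5 * (m * N\<^sup>2)" using mN N1 by linarith
  show ?thesis
    unfolding main_code_def
    by (rule triple_weaken[OF triple_Seq[OF size_code triple_Seq[OF block_code
          triple_Seq[OF table_code triple_Seq[OF edge_code target_code]]]]])
      (use size block table edge target in linarith)+
qed

section \<open>Loading, output and the whole program\<close>

abbreviation "norm_sum \<equiv> \<Sum>r<m. t r * t r"

text \<open>The resulting memory is described exactly, because the loops require the narrow bound
  \<open>L\<close> for all arrays except 0, and a triple of width \<open>W\<close> does not provide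
  it.\<close>

lemma load_code:
  assumes "\<And>i. i < 3 \<Longrightarrow> bits (h i) \<le> W * w"
  shows "triple w W UNIV (\<lambda>s. s = s0 \<and> s 0 = h)
    load_code (\<lambda>s. s = s0(7 := (s0 7)(0 := h 0), 8 := (s0 8)(0 := h 1), 9 := (s0 9)(0 := h 2))) 3"
proof -
  have 1: "triple w W UNIV (\<lambda>s. s = s0 \<and> s 0 = h) (assign_var 7 (Cell 0 (Num 0)))
      (\<lambda>s. s = s0(7 := (s0 7)(0 := h 0)) \<and> s 0 = h) 1"
    using assms[of 0] by (intro triple_Assign) (auto simp: pair_cost_def)
  have 2: "triple w W UNIV (\<lambda>s. s = s0(7 := (s0 7)(0 := h 0)) \<and> s 0 = h) (assign_var 8 (Cell 0 (Num 1)))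
      (\<lambda>s. s = s0(7 := (s0 7)(0 := h 0), 8 := (s0 8)(0 := h 1)) \<and> s 0 = h) 1"
    using assms[of 1] by (intro triple_Assign) (auto simp: pair_cost_def)
  have 3: "triple w W UNIV (\<lambda>s. s = s0(7 := (s0 7)(0 := h 0), 8 := (s0 8)(0 := h 1)) \<and> s 0 = h)
      (assign_var 9 (Cell 0 (Num 2)))
      (\<lambda>s. s = s0(7 := (s0 7)(0 := h 0), 8 := (s0 8)(0 := h 1), 9 := (s0 9)(0 := h 2))) 1"
    using assms[of 2] by (intro triple_Assign) (auto simp: pair_cost_def)
  show ?thesis
    unfolding load_code_def by (rule triple_weaken[OF triple_Seq[OF 1 triple_Seq[OF 2 3]]]) auto
qed

text \<open>Squares of numerator and denominator of the distance have \<open>2 * R\<close> bits, and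
  their cofactors fit into \<open>L\<close> bits with room for a sign-free carry; the width is
  chosen so that \<open>W * w\<close> covers \<open>2 * R + L\<close>.\<close>

lemma output_code:
  assumes R: "bits (h 3) \<le> R" "bits (h 4) \<le> R" and W: "W = 10 * \<eta> + 2 * R"
  shows "triple w W UNIV
    (\<lambda>s. env s \<and> s 20 0 = norm_sum \<and> s 3 = a3 \<and> s 4 = a4 \<and> s 5 = a5)
    output_code
    (\<lambda>s. s 3 = a3 \<and> s 4 = a4 \<and> s 5 = a5 \<and> s 6 0 = h 3 * h 3 - h 4 * h 4 * norm_sum
       \<and> s 6 1 = h 4 * h 4 * (int q * int q) \<and> s 6 2 = int N) 3"
proof -
  have Rw: "2 * R + L \<le> W * w" using w_pos by (simp add: W algebra_simps)
  have big: "4 * w + 2 * \<eta> + 2 \<le> L" using less_L by simp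
  have p: "bits (h 3 * h 3) \<le> 2 * R" and d: "bits (h 4 * h 4) \<le> 2 * R"
    using bits_mult[of "h 3" "h 3"] bits_mult[of "h 4" "h 4"] R by linarith+
  have "(2::int) ^ (w + (\<eta> + \<eta>)) < 2 ^ (w + (\<eta> + \<eta>) + 1)" by simp
  then have "\<bar>norm_sum\<bar> < 2 ^ (w + (\<eta> + \<eta>) + 1)"
    using target_sum_bound[of m] by linarith
  then have "bits norm_sum \<le> w + (\<eta> + \<eta>) + 1" by (simp only: bits_le_iff)
  then have "bits (h 4 * h 4 * norm_sum) \<le> 2 * R + (w + (\<eta> + \<eta>) + 1)"
    using bits_mult[of "h 4 * h 4" norm_sum] d by linarith
  then have b0: "bits (h 3 * h 3 - h 4 * h 4 * norm_sum) \<le> W * w"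
    using bits_diff[of "h 3 * h 3" "h 4 * h 4 * norm_sum"] p Rw big w_pos by linarith
  have "int q < 2 ^ w" using q_le_M M_le_N N_le_w
    by (metis of_nat_less_iff of_nat_numeral of_nat_power order.strict_trans1 order.strict_trans order_less_imp_le)
  then have "bits (int q) \<le> w" by (simp add: bits_le_iff)
  then have b1: "bits (h 4 * h 4 * (int q * int q)) \<le> W * w"
    using bits_mult[of "h 4 * h 4" "int q * int q"] bits_mult[of "int q" "int q"] d Rw big by linarith
  have b2: "bits (int N) \<le> W * w" using bits_le_L_nat[of N] Rw by linarith
  have 1: "triple w W UNIV (\<lambda>s. env s \<and> s 20 0 = norm_sum \<and> s 3 = a3 \<and> s 4 = a4 \<and> s 5 = a5)
     (Assign 6 (Num 0) (Sub (Mul (Cell 0 (Num 3)) (Cell 0 (Num 3)))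
       (Mul (Mul (Cell 0 (Num 4)) (Cell 0 (Num 4))) (Var 20))))
     (\<lambda>s. env s \<and> s 3 = a3 \<and> s 4 = a4 \<and> s 5 = a5 \<and> s 6 0 = h 3 * h 3 - h 4 * h 4 * norm_sum) 1"
    using b0 by (intro triple_Assign) (auto simp: pair_cost_def env_def)
  have 2: "triple w W UNIV
     (\<lambda>s. env s \<and> s 3 = a3 \<and> s 4 = a4 \<and> s 5 = a5 \<and> s 6 0 = h 3 * h 3 - h 4 * h 4 * norm_sum)
     (Assign 6 (Num 1) (Mul (Mul (Cell 0 (Num 4)) (Cell 0 (Num 4))) (Mul (Var 10) (Var 10))))
     (\<lambda>s. env s \<and> s 3 = a3 \<and> s 4 = a4 \<and> s 5 = a5 \<and> s 6 0 = h 3 * h 3 - h 4 * h 4 * norm_sum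
       \<and> s 6 1 = h 4 * h 4 * (int q * int q)) 1"
    using b1 by (intro triple_Assign) (auto simp: pair_cost_def env_def)
  have 3: "triple w W UNIV
     (\<lambda>s. env s \<and> s 3 = a3 \<and> s 4 = a4 \<and> s 5 = a5 \<and> s 6 0 = h 3 * h 3 - h 4 * h 4 * norm_sum
       \<and> s 6 1 = h 4 * h 4 * (int q * int q))
     (Assign 6 (Num 2) (Var 12))
     (\<lambda>s. s 3 = a3 \<and> s 4 = a4 \<and> s 5 = a5 \<and> s 6 0 = h 3 * h 3 - h 4 * h 4 * norm_sum
       \<and> s 6 1 = h 4 * h 4 * (int q * int q) \<and> s 6 2 = int N) 1"
    using b2 by (intro triple_Assign) (auto simp: pair_cost_def env_def)
  show ?thesis
    unfolding output_code_def by (rule triple_weaken[OF triple_Seq[OF 1 triple_Seq[OF 2 3]]]) auto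
qed

lemma input_space:
  assumes s0: "s0 0 = h" "s0 1 = B" "s0 2 = t" "\<And>A. 3 \<le> A \<Longrightarrow> s0 A = (\<lambda>_. 0)"
    and h: "\<And>i. bits (h i) \<le> W * w" "\<And>i. 5 \<le> i \<Longrightarrow> h i = 0"
    and supp: "\<And>a. N * m \<le> a \<Longrightarrow> B a = 0" "\<And>a. m \<le> a \<Longrightarrow> t a = 0"
    and W: "1 \<le> W"
  shows "finite {(A, i). s0 A i \<noteq> 0}"
    and "mem_space w s0 \<le> 5 * (W + 5) + (N * m + m) * (20 * \<eta> + 2)"
proof -
  let ?S = "{(A, i). s0 A i \<noteq> 0}"
  let ?X = "{0} \<times> {..<5} \<union> ({1} \<times> {..<N * m} \<union> {2} \<times> {..<m}) :: (nat \<times> nat) set"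
  let ?g = "\<lambda>(A, i). words w (int i) + words w (s0 A i)"
  have sub: "?S \<subseteq> ?X"
  proof (rule subrelI, rule ccontr)
    fix A i assume "(A, i) \<in> ?S" "(A, i) \<notin> ?X"
    moreover have "A = 0 \<or> A = 1 \<or> A = 2 \<or> 3 \<le> A" by linarith
    ultimately show False using s0 h(2)[of i] supp[of i] by (auto simp: not_less)
  qed
  then show "finite ?S" by (rule finite_subset) auto
  have w0: "0 < w" using w_pos by simp
  have words_L: "words w x \<le> 10 * \<eta> + 1" if "bits x \<le> L" for x
    using words_le[OF w0 that] .
  have idx: "bits (int i) \<le> L" if "i < N * m" for i
  proof (rule bits_le_L)
    have "N * m \<le> 2 ^ w * 2 ^ w" using N_le_w m_le_w by (intro mult_le_mono) auto
    with that have "i \<le> 2 ^ (w + w)" by (simp add: power_add)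
    then have "int i \<le> int (2 ^ (w + w))" by (simp only: of_nat_le_iff)
    then show "\<bar>int i\<bar> \<le> 2 ^ (w + w)" by simp
  qed simp
  have coord: "bits x \<le> L" if "\<bar>x\<bar> \<le> 2 ^ \<eta>" for x
    using bits_le_L[OF that] by simp
  have "mem_space w s0 \<le> sum ?g ?X"
    unfolding mem_space_def by (rule sum_mono2[OF _ sub]) auto
  also have "\<dots> \<le> sum ?g ({0} \<times> {..<5}) + (sum ?g ({1} \<times> {..<N * m}) + sum ?g ({2} \<times> {..<m}))"
    by (subst sum.union_disjoint; (subst sum.union_disjoint)?) auto
  also have "sum ?g ({0} \<times> {..<5}) \<le> (\<Sum>_\<in>{0::nat} \<times> {..<5::nat}. W + 5)"
  proof (rule sum_mono)
    fix y assume y: "y \<in> {0::nat} \<times> {..<5::nat}"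
    have "bits (int (snd y)) \<le> 3" using y by (subst bits_le_iff) auto
    also have "3 \<le> 3 * w" using w_pos by simp
    finally have "words w (int (snd y)) \<le> 3 + 1" by (intro words_le w0)
    moreover have "words w (h (snd y)) \<le> W + 1" by (intro words_le w0 h)
    ultimately show "?g y \<le> W + 5" using y s0 by auto
  qed
  also have "sum ?g ({1} \<times> {..<N * m}) \<le> (\<Sum>_\<in>{1::nat} \<times> {..<N * m}. 20 * \<eta> + 2)"
  proof (rule sum_mono)
    fix y assume y: "y \<in> {1::nat} \<times> {..<N * m}"
    have "words w (int (snd y)) \<le> 10 * \<eta> + 1" using y by (intro words_L idx) auto
    moreover have "words w (B (snd y)) \<le> 10 * \<eta> + 1" using B by (intro words_L coord)
    ultimately show "?g y \<le> 20 * \<eta> + 2" using y s0 by auto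
  qed
  also have "sum ?g ({2} \<times> {..<m}) \<le> (\<Sum>_\<in>{2::nat} \<times> {..<m}. 20 * \<eta> + 2)"
  proof (rule sum_mono)
    fix y assume y: "y \<in> {2::nat} \<times> {..<m}"
    have "bits (int (snd y)) \<le> L" using y by (intro bits_le_L_nat) auto
    then have "words w (int (snd y)) \<le> 10 * \<eta> + 1" by (rule words_L)
    moreover have "words w (t (snd y)) \<le> 10 * \<eta> + 1" using t by (intro words_L coord)
    ultimately show "?g y \<le> 20 * \<eta> + 2" using y s0 by auto
  qed
  finally show "mem_space w s0 \<le> 5 * (W + 5) + (N * m + m) * (20 * \<eta> + 2)"
    by (simp add: algebra_simps)
qed

text \<open>Loading and output run at width \<open>W\<close>, the loops at
  \<open>10 * \<eta>\<close>. Before the output the wide bound is restored: \<open>env\<close>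
  supplies array 0 unchanged, and \<open>L \<le> W * w\<close> covers all other arrays.\<close>

lemma program_run:
  assumes s0: "s0 0 = h" "s0 1 = B" "s0 2 = t" "\<And>A. 3 \<le> A \<Longrightarrow> s0 A = (\<lambda>_. 0)"
    and h: "h 0 = int n" "h 1 = int k" "h 2 = int m" "\<And>i. 5 \<le> i \<Longrightarrow> h i = 0"
    and R: "bits (h 3) \<le> R" "bits (h 4) \<le> R"
    and supp: "\<And>a. N * m \<le> a \<Longrightarrow> B a = 0" "\<And>a. m \<le> a \<Longrightarrow> t a = 0"
  obtains s T S where "run w program_code s0 s T S"
    "T \<le> 4000000 * (m * \<eta>\<^sup>2 * N\<^sup>2 + R\<^sup>2)" "S \<le> 4000000 * (m * \<eta>\<^sup>2 * N\<^sup>2 + R\<^sup>2)"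
    "s 3 = fill (N * N) adjacency" "s 4 = fill (N * N) numerators"
    "s 5 = fill (N * N) (\<lambda>_. denominator)"
    "s 6 0 = h 3 * h 3 - h 4 * h 4 * norm_sum" "s 6 1 = h 4 * h 4 * (int q * int q)" "s 6 2 = int N"
proof -
  define W where "W = 10 * \<eta> + 2 * R"
  have w: "1 \<le> w \<and> 3 \<le> W" "1 \<le> w \<and> 3 \<le> 10 * \<eta>" using w_pos \<eta> by (auto simp: W_def)
  have WL: "L \<le> W * w" by (simp add: W_def)
  have Rw: "R \<le> W * w"
  proof -
    have "R \<le> W" by (simp add: W_def)
    also have "\<dots> \<le> W * w" using w_pos by simp
    finally show ?thesis .
  qed
  have nk: "bits (int x) \<le> L" if "x \<in> {n, k, m}" for x
    using that n_le_N k_le_N by (intro bits_le_L_nat) auto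
  have bits_h: "bits (h i) \<le> W * w" for i
  proof -
    consider "i = 0" | "i = 1" | "i = 2" | "i = 3" | "i = 4" | "5 \<le> i" by linarith
    then show ?thesis
      using h R Rw nk[of n, THEN order_trans, OF _ WL] nk[of k, THEN order_trans, OF _ WL]
        nk[of m, THEN order_trans, OF _ WL]
      by cases auto
  qed
  have coord: "bits x \<le> L" if "\<bar>x\<bar> \<le> 2 ^ \<eta>" for x
    using bits_le_L[OF that] by simp
  have arrays: "A = 0 \<or> A = 1 \<or> A = 2 \<or> 3 \<le> A" for A :: nat by linarith
  have bits_s0: "bits (s0 A i) \<le> L" if "A \<noteq> 0" for A i
    using arrays[of A] that s0 coord[OF B, of i] coord[OF t, of i] by (auto simp del: One_nat_def)
  have "fits UNIV (W * w) s0"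
    unfolding fits_def using bits_s0 bits_h s0(1) WL by (metis le_trans)
  then obtain s1 T1 S1 where 1: "run w load_code s0 s1 T1 S1" "T1 \<le> 500 * W\<^sup>2 * 3"
    "s1 = s0(7 := (s0 7)(0 := h 0), 8 := (s0 8)(0 := h 1), 9 := (s0 9)(0 := h 2))"
    using load_code[of W s0, OF bits_h] w(1) s0(1) unfolding triple_def by blast
  have "fits (- {0}) L s1"
    unfolding fits_def 1(3) using bits_s0 nk h by (auto simp del: One_nat_def)
  moreover have "s1 0 = h \<and> s1 1 = B \<and> s1 2 = t \<and> s1 7 0 = int n \<and> s1 8 0 = int k \<and> s1 9 0 = int m
        \<and> (\<forall>A\<in>{3,4,5,10,13,14,20}. s1 A = (\<lambda>_. 0))"
    unfolding 1(3) using s0 h by simp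
  ultimately obtain s2 T2 S2 where 2: "run w main_code s1 s2 T2 S2"
    "T2 \<le> 500 * (10 * \<eta>)\<^sup>2 * (60 * (m * N\<^sup>2))" "fits (- {0}) L s2"
    "env s2 \<and> s2 20 0 = norm_sum \<and> s2 3 = fill (N * N) adjacency
        \<and> s2 4 = fill (N * N) numerators \<and> s2 5 = fill (N * N) (\<lambda>_. denominator)"
    using main_code w(2) unfolding triple_def by blast
  have "fits UNIV (W * w) s2"
    unfolding fits_def
  proof (intro ballI allI)
    fix A i show "bits (s2 A i) \<le> W * w"
    proof (cases "A = 0")
      case True
      then show ?thesis using 2(4) bits_h by (simp add: env_def)
    next
      case False
      then have "bits (s2 A i) \<le> L" using 2(3) by (simp add: fits_def)
      then show ?thesis using WL by linarith
    qed
  qed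
  with output_code[OF R W_def] 2(4) w(1) obtain s T3 S3 where
    3: "run w output_code s2 s T3 S3" "T3 \<le> 500 * W\<^sup>2 * 3"
    and s: "s 3 = fill (N * N) adjacency" "s 4 = fill (N * N) numerators"
    "s 5 = fill (N * N) (\<lambda>_. denominator)"
    "s 6 0 = h 3 * h 3 - h 4 * h 4 * norm_sum" "s 6 1 = h 4 * h 4 * (int q * int q)" "s 6 2 = int N"
    unfolding triple_def by blast
  define T where "T = T1 + (T2 + T3)"
  have run: "run w program_code s0 s T (max S1 (max S2 S3))"
    unfolding program_code_def T_def by (intro run.Seq[OF 1(1)] run.Seq[OF 2(1) 3(1)])
  define Z where "Z = m * \<eta>\<^sup>2 * N\<^sup>2 + R\<^sup>2"
  have mN: "1 \<le> m * N\<^sup>2" using m N_pos by simp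
  have \<eta>2: "\<eta>\<^sup>2 \<le> m * \<eta>\<^sup>2 * N\<^sup>2"
    using mult_le_mono1[OF mN, of "\<eta>\<^sup>2"] by (simp add: algebra_simps)
  \<comment> \<open>The square of the difference is nonnegative, so \<open>W\<^sup>2\<close> is at
    most twice the sum of the squares of \<open>10 * \<eta>\<close> and \<open>2 * R\<close>. The
    difference may be negative and is taken in the integers.\<close>
  have "W\<^sup>2 + (10 * \<eta> - 2 * int R)\<^sup>2 = 200 * \<eta>\<^sup>2 + 8 * R\<^sup>2"
    by (simp add: W_def power2_eq_square algebra_simps)
  then have "int (W\<^sup>2) \<le> int (200 * \<eta>\<^sup>2 + 8 * R\<^sup>2)"
    using zero_le_power2[of "10 * \<eta> - 2 * int R"] by linarith
  then have "W\<^sup>2 \<le> 200 * \<eta>\<^sup>2 + 8 * R\<^sup>2" unfolding of_nat_le_iff .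
  also have "\<dots> \<le> 200 * (m * \<eta>\<^sup>2 * N\<^sup>2) + 200 * R\<^sup>2"
    using \<eta>2 by (intro add_mono mult_le_mono) auto
  finally have W2: "W\<^sup>2 \<le> 200 * Z" by (simp add: Z_def)
  \<comment> \<open>The loops contribute 500 * 100 * 60 = 3000000, the six other assignments 6 * 500
    * 200 = 600000.\<close>
  have T: "T \<le> 3600000 * Z"
  proof -
    have "500 * (10 * \<eta>)\<^sup>2 * (60 * (m * N\<^sup>2)) = 3000000 * (m * \<eta>\<^sup>2 * N\<^sup>2)"
      by (simp add: power2_eq_square algebra_simps)
    also have "\<dots> \<le> 3000000 * Z" by (simp add: Z_def)
    finally show ?thesis using 1(2) 2(2) 3(2) W2 unfolding T_def by linarith
  qed
  have finite: "finite {(A, i). s0 A i \<noteq> 0}"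
    by (rule input_space(1)[OF s0 bits_h h(4) supp]) (use w(1) in auto)
  have space: "mem_space w s0 \<le> 5 * (W + 5) + (N * m + m) * (20 * \<eta> + 2)"
    by (rule input_space(2)[OF s0 bits_h h(4) supp]) (use w(1) in auto)
  have "W \<le> W\<^sup>2" by (simp add: power2_eq_square)
  then have "W \<le> 200 * Z" using W2 by (rule order_trans)
  moreover have "1 \<le> Z"
    using \<eta>2 \<eta> one_le_power[of \<eta> 2] unfolding Z_def by linarith
  ultimately have "5 * (W + 5) + y \<le> 1200 * Z" if "y \<le> 44 * Z" for y
    using that by simp
  moreover have "(N * m + m) * (20 * \<eta> + 2) \<le> 44 * Z"
  proof -
    have "20 * \<eta> + 2 \<le> 22 * \<eta>" using \<eta> by simp
    also have "\<dots> \<le> 22 * \<eta>\<^sup>2" by (simp add: power2_eq_square)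
    finally have "(N * m + m) * (20 * \<eta> + 2) \<le> (2 * (m * N\<^sup>2)) * (22 * \<eta>\<^sup>2)"
    proof (rule mult_le_mono[rotated])
      have "N * m \<le> m * N\<^sup>2" "m \<le> m * N\<^sup>2" using N_pos by (simp_all add: power2_eq_square)
      then show "N * m + m \<le> 2 * (m * N\<^sup>2)" by linarith
    qed
    then show ?thesis by (simp add: Z_def algebra_simps)
  qed
  ultimately have "mem_space w s0 \<le> 1200 * Z"
    using space by (meson order_trans)
  moreover have "max S1 (max S2 S3) \<le> mem_space w s0 + T"
    using run_space[OF run finite] w(1) by simp
  ultimately have "max S1 (max S2 S3) \<le> 4000000 * Z"
    using T by linarith
  then show ?thesis
    using T by (intro that[OF run _ _ s]) (simp_all add: Z_def)
qed

end

subsection \<open>The graph\<close>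

definition basis_array :: "cvp_instance \<Rightarrow> nat \<Rightarrow> int" where
  "basis_array I = (let m = dim_row (basis I) in
     (\<lambda>a. if a < m * dim_col (basis I) then basis I $$ (a mod m, a div m) else 0))"

definition target_array :: "cvp_instance \<Rightarrow> nat \<Rightarrow> int" where
  "target_array I = (\<lambda>i. if i < dim_row (basis I) then target I $ i else 0)"

definition block_size :: "nat \<Rightarrow> nat \<Rightarrow> nat" where
  "block_size n k = nat \<lceil>real n / real k\<rceil>"

text \<open>
  Dividing all weights and the threshold by \<open>block_size n k ^ 2\<close> does not affect the reduction,
  and without it the weights would exceed \<open>m * 2 ^ (2 * \<eta>)\<close> by that factor.
\<close>

definition clique_graph :: "nat \<Rightarrow> nat \<Rightarrow> cvp_instance \<Rightarrow> nat clique_instance" where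
  "clique_graph n k I = (let m = dim_row (basis I); q = block_size n k; N = num_verts n k;
       t = target_array I in
     \<lparr> verts = {..<N},
       edges = {{u, v} | u v. u < N \<and> v < N \<and> u div 2 ^ q \<noteq> v div 2 ^ q},
       weight = (\<lambda>e. of_int (edge_num k q m (basis_array I) t (Min e) (Max e))
                      / of_int ((int k - 1) * (int q * int q))),
       threshold = ((distance I)\<^sup>2 - of_int (\<Sum>r<m. t r * t r)) / of_int (int q * int q) \<rparr>)"

text \<open>Array 4 holds a numerator for each ordered pair, whereas a weight belongs to a set and
  is read off at its \<open>Min\<close> and \<open>Max\<close>.\<close>

lemma edge_num_commute: "edge_num k q m B t u v = edge_num k q m B t v u"
  by (simp add: edge_num_def edge_term_def algebra_simps)

lemma nsets_2_insert:
  assumes "x \<notin> K"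
  shows "[insert x K]\<^bsup>2\<^esup> = [K]\<^bsup>2\<^esup> \<union> (\<lambda>v. {x, v}) ` K"
  using assms by (auto simp: nsets_2_eq)

text \<open>The coefficient \<open>k - 1\<close> and the degree \<open>card K - 1\<close> are kept
  apart, so that the induction can enlarge \<open>K\<close> with \<open>k\<close> fixed. By symmetry
  of the term, \<open>Min\<close> and \<open>Max\<close> merely orient an edge.\<close>

lemma sum_edge_term:
  fixes K :: "nat set" and b :: "nat \<Rightarrow> int"
  assumes "finite K"
  shows "(\<Sum>e\<in>[K]\<^bsup>2\<^esup>. edge_term k t (b (Min e)) (b (Max e)))
    = (k - 1) * ((\<Sum>u\<in>K. b u)\<^sup>2 - (\<Sum>u\<in>K. (b u)\<^sup>2))
      + (int (card K) - 1) * (\<Sum>u\<in>K. (b u)\<^sup>2 - 2 * t * b u)"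
  using assms
proof (induction K rule: finite_induct)
  case empty
  then show ?case by (simp add: nsets_eq_empty)
next
  case (insert x K)
  let ?w = "\<lambda>e. edge_term k t (b (Min e)) (b (Max e))"
  have disj: "[K]\<^bsup>2\<^esup> \<inter> (\<lambda>v. {x, v}) ` K = {}"
    using insert.hyps by (auto simp: nsets_def)
  have inj: "inj_on (\<lambda>v. {x, v}) K"
    by (auto simp: inj_on_def doubleton_eq_iff)
  have pair: "edge_term k t (b (min x v)) (b (max x v)) = edge_term k t (b x) (b v)" for v
    by (cases "x \<le> v") (auto simp: edge_term_def max_def min_def algebra_simps)
  have "(\<Sum>v\<in>K. edge_term k t (b x) (b v)) = (\<Sum>v\<in>K. 2 * (k - 1) * b x * b v
      + ((b x)\<^sup>2 - 2 * t * b x) + ((b v)\<^sup>2 - 2 * t * b v))"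
    by (rule sum.cong) (auto simp: edge_term_def algebra_simps power2_eq_square)
  also have "\<dots> = 2 * (k - 1) * b x * (\<Sum>v\<in>K. b v) + int (card K) * ((b x)\<^sup>2 - 2 * t * b x)
      + (\<Sum>v\<in>K. (b v)\<^sup>2 - 2 * t * b v)"
    by (simp only: sum.distrib sum_distrib_left sum_constant)
  finally have star: "(\<Sum>v\<in>K. edge_term k t (b x) (b v)) = \<dots>" .
  have "(\<Sum>e\<in>[insert x K]\<^bsup>2\<^esup>. ?w e) = (\<Sum>e\<in>[K]\<^bsup>2\<^esup>. ?w e) + (\<Sum>v\<in>K. edge_term k t (b x) (b v))"
    using insert.hyps disj finite_imp_finite_nsets[of K 2]
    by (simp add: nsets_2_insert sum.union_disjoint sum.reindex[OF inj] pair)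
  also have "\<dots> = (k - 1) * ((b x + (\<Sum>u\<in>K. b u))\<^sup>2 - ((b x)\<^sup>2 + (\<Sum>u\<in>K. (b u)\<^sup>2)))
      + int (card K) * (((b x)\<^sup>2 - 2 * t * b x) + (\<Sum>u\<in>K. (b u)\<^sup>2 - 2 * t * b u))"
    unfolding insert.IH star by (simp add: power2_eq_square algebra_simps)
  finally show ?case using insert.hyps by simp
qed

text \<open>For \<open>card K = k\<close> the sums of squares cancel, and completing the square in
  each coordinate gives the claim.\<close>

lemma sum_edge_num:
  assumes "finite K" "card K = k"
  shows "(\<Sum>e\<in>[K]\<^bsup>2\<^esup>. edge_num k q m B t (Min e) (Max e))
    = (int k - 1) * ((\<Sum>r<m. ((\<Sum>u\<in>K. vertex_vec q m B u r) - t r)\<^sup>2) - (\<Sum>r<m. t r * t r))"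
proof -
  have "(\<Sum>e\<in>[K]\<^bsup>2\<^esup>. edge_num k q m B t (Min e) (Max e))
    = (\<Sum>r<m. \<Sum>e\<in>[K]\<^bsup>2\<^esup>. edge_term (int k) (t r) (vertex_vec q m B (Min e) r) (vertex_vec q m B (Max e) r))"
    unfolding edge_num_def by (rule sum.swap)
  also have "\<dots> = (\<Sum>r<m. (int k - 1) * (((\<Sum>u\<in>K. vertex_vec q m B u r) - t r)\<^sup>2 - t r * t r))"
  proof (rule sum.cong)
    fix r
    let ?b = "\<lambda>u. vertex_vec q m B u r"
    have split: "(\<Sum>u\<in>K. (?b u)\<^sup>2 - 2 * t r * ?b u) = (\<Sum>u\<in>K. (?b u)\<^sup>2) - 2 * t r * (\<Sum>u\<in>K. ?b u)"
      by (simp only: sum_subtractf sum_distrib_left)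
    show "(\<Sum>e\<in>[K]\<^bsup>2\<^esup>. edge_term (int k) (t r) (?b (Min e)) (?b (Max e)))
        = (int k - 1) * (((\<Sum>u\<in>K. ?b u) - t r)\<^sup>2 - t r * t r)"
      unfolding sum_edge_term[OF assms(1), of "int k" "t r" ?b] assms(2) split
      by (simp add: power2_eq_square algebra_simps)
  qed simp
  finally show ?thesis
    by (simp add: sum_distrib_left sum_subtractf right_diff_distrib)
qed

section \<open>Cliques and binary vectors\<close>

lemma block_size_pos: "1 \<le> n \<Longrightarrow> 1 \<le> k \<Longrightarrow> 0 < block_size n k"
  unfolding block_size_def by (simp add: zero_less_nat_eq less_ceiling_iff)

lemma le_block_size: "1 \<le> k \<Longrightarrow> n \<le> k * block_size n k"
proof -
  assume k: "1 \<le> k"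
  have "real n / real k \<le> real (block_size n k)"
    unfolding block_size_def by (rule real_nat_ceiling_ge)
  then have "real n \<le> real (k * block_size n k)"
    using k by (simp add: field_simps)
  then show ?thesis by (simp only: of_nat_le_iff)
qed

lemma num_verts_eq: "num_verts n k = k * 2 ^ block_size n k"
  by (simp add: num_verts_def block_size_def)

lemma clique_graph_simps [simp]:
  "verts (clique_graph n k I) = {..<num_verts n k}"
  "weight (clique_graph n k I) e = of_int (edge_num k (block_size n k) (dim_row (basis I))
      (basis_array I) (target_array I) (Min e) (Max e))
      / of_int ((int k - 1) * (int (block_size n k) * int (block_size n k)))"
  "threshold (clique_graph n k I) = ((distance I)\<^sup>2
     - of_int (\<Sum>r<dim_row (basis I). target_array I r * target_array I r))
      / of_int (int (block_size n k) * int (block_size n k))"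
  by (simp_all add: clique_graph_def Let_def)

lemma edges_clique_graph:
  "edges (clique_graph n k I) = {{u, v} | u v. u < num_verts n k \<and> v < num_verts n k
     \<and> u div 2 ^ block_size n k \<noteq> v div 2 ^ block_size n k}"
  by (simp add: clique_graph_def Let_def)

lemma valid_clique_graph: "valid_graph (num_verts n k) (clique_graph n k I)"
  by (auto simp: valid_graph_def edges_clique_graph)

lemma doubleton_in_edges:
  "{u, v} \<in> edges (clique_graph n k I) \<longleftrightarrow> u < num_verts n k \<and> v < num_verts n k
     \<and> u div 2 ^ block_size n k \<noteq> v div 2 ^ block_size n k"
  by (auto simp: edges_clique_graph doubleton_eq_iff)

text \<open>Adjacency makes the block map injective on a clique, and \<open>k\<close> vertices in
  \<open>k\<close> blocks make it bijective; \<sigma> is its inverse. Conversely,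
  \<open>\<sigma> i div 2 ^ block_size n k = i\<close> with \<open>i < k\<close> already bounds
  \<open>\<sigma> i\<close> by the number of vertices.\<close>

lemma k_cliques_clique_graph:
  "K \<in> k_cliques k (clique_graph n k I) \<longleftrightarrow>
     (\<exists>\<sigma>. (\<forall>i<k. \<sigma> i div 2 ^ block_size n k = i) \<and> K = \<sigma> ` {..<k})"
proof
  let ?M = "2 ^ block_size n k :: nat"
  assume "K \<in> k_cliques k (clique_graph n k I)"
  then have K: "K \<subseteq> {..<num_verts n k}" "finite K" "card K = k"
    and edges: "[K]\<^bsup>2\<^esup> \<subseteq> edges (clique_graph n k I)"
    by (auto simp: k_cliques_def nsets_def)
  have inj: "inj_on (\<lambda>u. u div ?M) K"
  proof (rule inj_onI, rule ccontr)
    fix u v assume "u \<in> K" "v \<in> K" "u div ?M = v div ?M" "u \<noteq> v"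
    then have "{u, v} \<in> [K]\<^bsup>2\<^esup>" by simp
    then show False
      using edges doubleton_in_edges[of u v n k I] \<open>u div ?M = v div ?M\<close> by blast
  qed
  moreover have "(\<lambda>u. u div ?M) ` K \<subseteq> {..<k}"
    using K(1) by (auto simp: num_verts_eq less_mult_imp_div_less)
  then have "(\<lambda>u. u div ?M) ` K = {..<k}"
    using K by (intro card_subset_eq) (auto simp: card_image[OF inj])
  ultimately have bij: "bij_betw (\<lambda>u. u div ?M) K {..<k}"
    by (simp add: bij_betw_def)
  let ?s = "inv_into K (\<lambda>u. u div ?M)"
  have "\<forall>i<k. ?s i div ?M = i"
    using f_inv_into_f[of _ "\<lambda>u. u div ?M" K] bij by (simp add: bij_betw_def)
  moreover have "K = ?s ` {..<k}"
    using bij_betw_inv_into[OF bij] by (simp add: bij_betw_def)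
  ultimately show "\<exists>\<sigma>. (\<forall>i<k. \<sigma> i div ?M = i) \<and> K = \<sigma> ` {..<k}" by blast
next
  let ?M = "2 ^ block_size n k :: nat"
  assume "\<exists>\<sigma>. (\<forall>i<k. \<sigma> i div ?M = i) \<and> K = \<sigma> ` {..<k}"
  then obtain \<sigma> where \<sigma>: "\<And>i. i < k \<Longrightarrow> \<sigma> i div ?M = i" and K: "K = \<sigma> ` {..<k}" by blast
  have inj: "inj_on \<sigma> {..<k}"
    by (rule inj_onI) (metis \<sigma> lessThan_iff)
  have "\<sigma> i < num_verts n k" if "i < k" for i
    using \<sigma>[OF that] that div_less_iff_less_mult[of ?M "\<sigma> i" k] by (simp add: num_verts_eq)
  moreover have "card K = k" using inj by (simp add: K card_image)
  ultimately have "K \<in> [verts (clique_graph n k I)]\<^bsup>k\<^esup>"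
    by (auto simp: K nsets_def)
  moreover have "[K]\<^bsup>2\<^esup> \<subseteq> edges (clique_graph n k I)"
  proof
    fix e assume "e \<in> [K]\<^bsup>2\<^esup>"
    then obtain i j where "e = {\<sigma> i, \<sigma> j}" "i < k" "j < k" "\<sigma> i \<noteq> \<sigma> j"
      by (auto simp: K nsets_2_eq)
    then show "e \<in> edges (clique_graph n k I)"
      using \<sigma> \<open>\<And>i. i < k \<Longrightarrow> \<sigma> i < num_verts n k\<close>
      by (metis doubleton_in_edges)
  qed
  ultimately show "K \<in> k_cliques k (clique_graph n k I)"
    by (simp add: k_cliques_def)
qed

text \<open>Glues the chosen partial assignments together. Bits at padded positions are dropped, so
  different choices may select the same vector.\<close>

definition selected :: "nat \<Rightarrow> nat \<Rightarrow> (nat \<Rightarrow> nat) \<Rightarrow> int vec" where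
  "selected n q \<sigma> = Matrix.vec n (\<lambda>c. of_bool (bit (\<sigma> (c div q)) (c mod q)))"

lemma sum_vertex_vec:
  fixes I :: cvp_instance and n k :: nat
  defines "m \<equiv> dim_row (basis I)" and "q \<equiv> block_size n k"
  assumes \<sigma>: "\<And>i. i < k \<Longrightarrow> \<sigma> i div 2 ^ q = i" and n: "dim_col (basis I) = n" and k: "1 \<le> k"
    and r: "r < m"
  shows "(\<Sum>u\<in>\<sigma> ` {..<k}. vertex_vec q m (basis_array I) u r) = (basis I *\<^sub>v selected n q \<sigma>) $ r"
proof -
  let ?B = "basis_array I"
  have inj: "inj_on \<sigma> {..<k}"
    by (rule inj_onI) (metis \<sigma> lessThan_iff)
  define g where "g c = of_bool (bit (\<sigma> (c div q)) (c mod q)) * ?B (c * m + r)" for c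
  have "(\<Sum>u\<in>\<sigma> ` {..<k}. vertex_vec q m ?B u r) = (\<Sum>i<k. \<Sum>j<q. of_bool (bit (\<sigma> i) j) * ?B ((i * q + j) * m + r))"
    using \<sigma> by (simp add: sum.reindex[OF inj] vertex_vec_def)
  also have "\<dots> = (\<Sum>i<k. sum g {i * q..<i * q + q})"
  proof (rule sum.cong[OF refl])
    fix i
    have "sum g {i * q..<i * q + q} = (\<Sum>j<q. g (i * q + j))"
      by (simp add: sum.shift_bounds_nat_ivl[of g 0 "i * q" q, simplified] add.commute lessThan_atLeast0)
    also have "\<dots> = (\<Sum>j<q. of_bool (bit (\<sigma> i) j) * ?B ((i * q + j) * m + r))"
      by (rule sum.cong) (auto simp: g_def)
    finally show "(\<Sum>j<q. of_bool (bit (\<sigma> i) j) * ?B ((i * q + j) * m + r)) = sum g {i * q..<i * q + q}" ..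
  qed
  also have "\<dots> = sum g {..<k * q}"
    by (rule sum.nat_group)
  \<comment> \<open>The padding columns from \<open>n\<close> on lie past the end of the basis
    array, where it is 0.\<close>
  also have "\<dots> = sum g {..<n}"
  proof (rule sum.mono_neutral_right)
    show "{..<n} \<subseteq> {..<k * q}" using le_block_size[OF k, of n] by (auto simp: q_def)
    show "\<forall>c\<in>{..<k * q} - {..<n}. g c = 0"
    proof
      fix c assume "c \<in> {..<k * q} - {..<n}"
      then have "n * m \<le> c * m" by (intro mult_le_mono1) simp
      then have "\<not> c * m + r < m * n" unfolding mult.commute[of m n] by linarith
      then show "g c = 0" by (simp add: g_def basis_array_def Let_def n mult.commute flip: m_def)
    qed
  qed simp
  also have "\<dots> = (\<Sum>c<n. basis I $$ (r, c) * selected n q \<sigma> $ c)"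
  proof (rule sum.cong)
    fix c assume c: "c \<in> {..<n}"
    have "c * m + r < Suc c * m" using r by simp
    also have "\<dots> \<le> n * m" using c by (intro mult_le_mono1) simp
    finally have "c * m + r < m * n" by (simp add: mult.commute)
    then show "g c = basis I $$ (r, c) * selected n q \<sigma> $ c"
      using c r by (simp add: g_def basis_array_def Let_def n selected_def flip: m_def)
  qed simp
  also have "\<dots> = (basis I *\<^sub>v selected n q \<sigma>) $ r"
    using r n by (simp add: m_def scalar_prod_def selected_def lessThan_atLeast0)
  finally show ?thesis .
qed

text \<open>Squaring replaces a comparison with a real root by one between rationals, where weights
  and threshold live.\<close>

lemma l2_norm_le_iff:
  assumes "0 < d"
  shows "l2_norm v \<le> real_of_rat d \<longleftrightarrow> of_int (\<Sum>i<dim_vec v. (v $ i)\<^sup>2) \<le> d\<^sup>2"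
proof -
  have "l2_norm v \<le> real_of_rat d \<longleftrightarrow> (l2_norm v)\<^sup>2 \<le> (real_of_rat d)\<^sup>2"
    using assms by (simp add: l2_norm_def L2_set_nonneg power_mono_iff)
  also have "(l2_norm v)\<^sup>2 = real_of_rat (of_int (\<Sum>i<dim_vec v. (v $ i)\<^sup>2))"
    by (simp add: l2_norm_def L2_set_def sum_nonneg del: of_int_sum) simp
  also have "(real_of_rat d)\<^sup>2 = real_of_rat (d\<^sup>2)"
    by (simp add: of_rat_power)
  finally show ?thesis by (simp only: of_rat_less_eq)
qed

text \<open>Once \<open>k - 1\<close> is cancelled, weight and threshold share the shift by the
  squared norm of the target and the divisor \<open>q\<^sup>2\<close>, so the comparison is one of
  squared distances.\<close>

lemma clique_weight_iff:
  assumes I: "valid_cvp n I" and n: "1 \<le> n" and k: "2 \<le> k"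
    and \<sigma>: "\<And>i. i < k \<Longrightarrow> \<sigma> i div 2 ^ block_size n k = i"
  shows "(\<Sum>e\<in>[\<sigma> ` {..<k}]\<^bsup>2\<^esup>. weight (clique_graph n k I) e) \<le> threshold (clique_graph n k I)
    \<longleftrightarrow> l2_norm (basis I *\<^sub>v selected n (block_size n k) \<sigma> - target I) \<le> real_of_rat (distance I)"
proof -
  let ?m = "dim_row (basis I)" and ?q = "block_size n k" and ?K = "\<sigma> ` {..<k}" and ?t = "target_array I"
  let ?v = "basis I *\<^sub>v selected n ?q \<sigma> - target I"
  let ?tt = "\<Sum>r<?m. ?t r * ?t r" and ?S = "\<Sum>r<?m. (?v $ r)\<^sup>2"
  have dims: "dim_col (basis I) = n" "target I \<in> carrier_vec ?m" "0 < distance I"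
    using I by (auto simp: valid_cvp_def)
  have inj: "inj_on \<sigma> {..<k}"
    by (rule inj_onI) (metis \<sigma> lessThan_iff)
  have k1: "1 \<le> k" using k by simp
  have q: "0 < ?q" using block_size_pos n k by simp
  have S: "(\<Sum>r<?m. ((\<Sum>u\<in>?K. vertex_vec ?q ?m (basis_array I) u r) - ?t r)\<^sup>2) = ?S"
  proof (rule sum.cong)
    fix r assume "r \<in> {..<?m}"
    then show "((\<Sum>u\<in>?K. vertex_vec ?q ?m (basis_array I) u r) - ?t r)\<^sup>2 = (?v $ r)\<^sup>2"
      using sum_vertex_vec[OF \<sigma> dims(1) k1, of r] dims(2) by (simp add: target_array_def)
  qed simp
  have "(\<Sum>e\<in>[?K]\<^bsup>2\<^esup>. weight (clique_graph n k I) e)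
      = of_int (\<Sum>e\<in>[?K]\<^bsup>2\<^esup>. edge_num k ?q ?m (basis_array I) ?t (Min e) (Max e))
        / of_int ((int k - 1) * (int ?q * int ?q))"
    by (simp add: sum_divide_distrib)
  also have "\<dots> = of_int ((int k - 1) * (?S - ?tt)) / of_int ((int k - 1) * (int ?q * int ?q))"
    by (subst sum_edge_num) (use inj in \<open>auto simp: card_image S\<close>)
  also have "\<dots> = (of_int ?S - of_int ?tt) / of_int (int ?q * int ?q)"
    using k by (simp only: of_int_mult of_int_diff mult_divide_mult_cancel_left_if) auto
  finally have "(\<Sum>e\<in>[?K]\<^bsup>2\<^esup>. weight (clique_graph n k I) e) \<le> threshold (clique_graph n k I)
      \<longleftrightarrow> of_int ?S \<le> (distance I)\<^sup>2"
    using q by (simp add: divide_le_cancel del: of_int_sum)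
  also have "\<dots> \<longleftrightarrow> l2_norm ?v \<le> real_of_rat (distance I)"
    using l2_norm_le_iff[OF dims(3), of ?v] dims(2) by simp
  finally show ?thesis .
qed

lemma ex_selected:
  assumes "z \<in> binary_vecs n" and q: "0 < q"
  obtains \<sigma> where "\<And>i. \<sigma> i div 2 ^ q = i" "selected n q \<sigma> = z"
proof -
  \<comment> \<open>At padded positions \<open>z\<close> is read outside its dimension, with an
    unspecified result; \<open>selected\<close> looks only at positions below
    \<open>n\<close>.\<close>
  define bs where "bs i = map (\<lambda>j. z $ (i * q + j) = 1) [0..<q]" for i
  define \<sigma> where "\<sigma> i = i * 2 ^ q + horner_sum of_bool 2 (bs i)" for i :: nat
  have less: "horner_sum of_bool 2 (bs i) < (2::nat) ^ q" for i
    using horner_sum_of_bool_2_less[of "bs i", where 'a = nat] by (simp add: bs_def)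
  have bit: "bit (\<sigma> i) j \<longleftrightarrow> z $ (i * q + j) = 1" if "j < q" for i j
  proof -
    have "take_bit q (\<sigma> i) = horner_sum of_bool 2 (bs i)"
      using less[of i] by (simp add: take_bit_eq_mod \<sigma>_def)
    then have "bit (\<sigma> i) j \<longleftrightarrow> bit (horner_sum of_bool 2 (bs i) :: nat) j"
      using that by (metis bit_take_bit_iff)
    then show ?thesis using that by (simp add: bit_horner_sum_bit_iff bs_def)
  qed
  show ?thesis
  proof
    show "\<sigma> i div 2 ^ q = i" for i using less[of i] by (simp add: \<sigma>_def)
    have "of_bool (z $ c = 1) = z $ c" if "c < n" for c
      using assms(1) that by (auto simp: binary_vecs_def)
    then show "selected n q \<sigma> = z"
      using assms by (intro eq_vecI) (auto simp: selected_def binary_vecs_def bit)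
  qed
qed

lemma selected_binary: "selected n q \<sigma> \<in> binary_vecs n"
  by (auto simp: selected_def binary_vecs_def)

lemma karp_reduction_clique_graph:
  assumes n: "1 \<le> n" and k: "2 \<le> k"
  shows "karp_reduction (cvp01 n) (min_weight_clique k (num_verts n k)) (clique_graph n k)"
proof -
  let ?q = "block_size n k"
  have q: "0 < ?q" using block_size_pos n k by simp
  have yes: "\<exists>K\<in>k_cliques k (clique_graph n k I).
      (\<Sum>e\<in>[K]\<^bsup>2\<^esup>. weight (clique_graph n k I) e) \<le> threshold (clique_graph n k I)"
    if I: "valid_cvp n I" and z: "z \<in> binary_vecs n"
      "l2_norm (basis I *\<^sub>v z - target I) \<le> real_of_rat (distance I)" for I z
  proof -
    obtain \<sigma> where \<sigma>: "\<And>i. \<sigma> i div 2 ^ ?q = i" "selected n ?q \<sigma> = z"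
      using ex_selected[OF z(1) q] by blast
    then have "\<sigma> ` {..<k} \<in> k_cliques k (clique_graph n k I)"
      unfolding k_cliques_clique_graph by blast
    then show ?thesis
      using clique_weight_iff[OF I n k, of \<sigma>] \<sigma> z(2) by blast
  qed
  have no: "threshold (clique_graph n k I) < (\<Sum>e\<in>[K]\<^bsup>2\<^esup>. weight (clique_graph n k I) e)"
    if I: "valid_cvp n I" and far: "\<forall>z\<in>binary_vecs n. real_of_rat (distance I)
        < l2_norm (basis I *\<^sub>v z - target I)"
      and K: "K \<in> k_cliques k (clique_graph n k I)" for I K
  proof -
    obtain \<sigma> where \<sigma>: "\<And>i. i < k \<Longrightarrow> \<sigma> i div 2 ^ ?q = i" and "K = \<sigma> ` {..<k}"
      using K unfolding k_cliques_clique_graph by blast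
    moreover have "real_of_rat (distance I) < l2_norm (basis I *\<^sub>v selected n ?q \<sigma> - target I)"
      using far selected_binary by blast
    ultimately show ?thesis
      using clique_weight_iff[OF I n k, of \<sigma>] by (metis not_le)
  qed
  show ?thesis
    unfolding karp_reduction_def cvp01_def min_weight_clique_def
    using yes no valid_clique_graph by auto
qed

text \<open>Without rows every column is the zero vector, which contradicts independence. The time
  bound relies on this: for \<open>m = 0\<close> its main term would vanish, although the loops over
  pairs of vertices still run.\<close>

lemma dim_row_pos:
  assumes "valid_cvp n I" "1 \<le> n"
  shows "0 < dim_row (basis I)"
proof (rule ccontr)
  assume "\<not> 0 < dim_row (basis I)"
  then have m: "dim_row (basis I) = 0" by simp
  let ?C = "cols (map_mat real_of_int (basis I))"
  interpret V: vec_space "TYPE(real)" 0 .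
  have "length ?C = n" using assms by (simp add: valid_cvp_def)
  then have "?C ! 0 \<in> set ?C" using assms by (intro nth_mem) simp
  moreover have C: "set ?C \<subseteq> carrier_vec 0"
    using cols_dim[of "map_mat real_of_int (basis I)"] m by simp
  ultimately have "0\<^sub>v 0 \<in> set ?C" by (metis eq_vecI carrier_vecD index_zero_vec(2) not_less0 subsetD)
  moreover have "module.lin_indpt class_ring (module_vec TYPE(real) 0) (set ?C)"
    using assms m by (simp add: valid_cvp_def linearly_independent_cols_def)
  moreover have "(UNIV :: real set) \<noteq> {0}" by (metis UNIV_I one_neq_zero singletonD)
  ultimately show False
    using V.zero_nin_lin_indpt[OF C] by simp
qed

subsection \<open>The reduction computed by the program\<close>

text \<open>The run has to be exhibited before any \<eta> is given, but its analysis requires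
  one.\<close>

lemma ex_coords_bounded: "\<exists>\<eta>\<ge>1. coords_bounded \<eta> I"
proof -
  have "\<exists>\<eta>\<ge>1. \<forall>x\<in>X. \<bar>x\<bar> \<le> 2 ^ \<eta>" if "finite X" for X :: "int set"
    using that
  proof (induction X rule: finite_induct)
    case empty
    then show ?case by auto
  next
    case (insert y X)
    then obtain \<eta> where \<eta>: "1 \<le> \<eta>" "\<And>x. x \<in> X \<Longrightarrow> \<bar>x\<bar> \<le> 2 ^ \<eta>" by blast
    have le: "(2::int) ^ \<eta> \<le> 2 ^ (\<eta> + bits y)" "(2::int) ^ bits y \<le> 2 ^ (\<eta> + bits y)"
      by (intro power_increasing; simp)+
    have "\<bar>x\<bar> \<le> 2 ^ (\<eta> + bits y)" if "x \<in> insert y X" for x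
    proof (cases "x = y")
      case True
      then show ?thesis using abs_less_bits[of y] le(2) by linarith
    next
      case False
      with that have "\<bar>x\<bar> \<le> 2 ^ \<eta>" using \<eta>(2) by simp
      then show ?thesis using le(1) by linarith
    qed
    then show ?case using \<eta>(1) by (intro exI[of _ "\<eta> + bits y"]) auto
  qed
  moreover let ?X = "(\<lambda>(i, j). basis I $$ (i, j)) ` ({..<dim_row (basis I)} \<times> {..<dim_col (basis I)})
      \<union> (\<lambda>i. target I $ i) ` {..<dim_vec (target I)}"
  have "finite ?X" by simp
  ultimately obtain \<eta> where "1 \<le> \<eta>" "\<forall>x\<in>?X. \<bar>x\<bar> \<le> 2 ^ \<eta>" by blast
  then show ?thesis by (intro exI[of _ \<eta>]) (auto simp: coords_bounded_def)
qed

definition parameters :: "nat \<Rightarrow> nat \<Rightarrow> cvp_instance \<Rightarrow> nat \<Rightarrow> int" where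
  "parameters n k I = cvp_input n k I 0"

locale cvp_reduction =
  fixes n k w \<eta> :: nat and I :: cvp_instance
  assumes n1: "1 \<le> n" and k2: "2 \<le> k" and \<eta>1: "1 \<le> \<eta>"
    and valid: "valid_cvp n I" and word: "dim_row (basis I) + num_verts n k \<le> 2 ^ w"
    and bounded: "coords_bounded \<eta> I"
begin

lemma dims: "dim_col (basis I) = n" "dim_vec (target I) = dim_row (basis I)"
  using valid by (auto simp: valid_cvp_def)

sublocale clique_program w \<eta> n k "dim_row (basis I)" "block_size n k" "2 ^ block_size n k"
  "num_verts n k" "parameters n k I" "basis_array I" "target_array I"
proof
  show "1 \<le> dim_row (basis I)" using dim_row_pos[OF valid n1] by simp
  show "\<bar>basis_array I a\<bar> \<le> 2 ^ \<eta>" for a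
  proof (cases "a < dim_row (basis I) * n")
    case True
    moreover from True have "0 < dim_row (basis I)" by (cases "dim_row (basis I)") auto
    ultimately show ?thesis
      using bounded dims
      by (simp add: basis_array_def Let_def coords_bounded_def less_mult_imp_div_less mult.commute)
  qed (simp add: basis_array_def Let_def dims)
  show "\<bar>target_array I a\<bar> \<le> 2 ^ \<eta>" for a
    using bounded dims by (simp add: target_array_def coords_bounded_def)
qed (use n1 k2 \<eta>1 word in \<open>simp_all add: block_size_def num_verts_def\<close>)

text \<open>The denominator cancels \<open>q\<^sup>2\<close>, and \<open>k \<le> 2 * (k - 1)\<close>
  turns the remaining factor 4 into 8.\<close>

lemma weight_bound: "\<bar>weight (clique_graph n k I) e\<bar> \<le> of_nat (8 * (dim_row (basis I) * 2 ^ (2 * \<eta>)))"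
proof -
  let ?m = "dim_row (basis I)" and ?q = "block_size n k"
  let ?den = "(int k - 1) * (int ?q * int ?q)"
  let ?num = "edge_num k ?q ?m (basis_array I) (target_array I) (Min e) (Max e)"
  have den: "0 < ?den" using q_pos k2 by simp
  have "\<bar>?num\<bar> \<le> 4 * int ?m * int k * (int ?q * 2 ^ \<eta>)\<^sup>2"
    unfolding edge_num_def by (rule edge_sum_bound) simp
  also have "\<dots> = 4 * (int ?m * 2 ^ (2 * \<eta>) * (int ?q * int ?q)) * int k"
    by (simp add: power2_eq_square power_add mult_2)
  also have "\<dots> \<le> 4 * (int ?m * 2 ^ (2 * \<eta>) * (int ?q * int ?q)) * (2 * (int k - 1))"
    using k2 by (intro mult_left_mono) auto
  also have "\<dots> = int (8 * (?m * 2 ^ (2 * \<eta>))) * ?den"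
    by simp
  finally have "of_int \<bar>?num\<bar> \<le> (of_int (int (8 * (?m * 2 ^ (2 * \<eta>))) * ?den) :: rat)"
    by (simp only: of_int_le_iff)
  then have "\<bar>of_int ?num\<bar> \<le> (of_nat (8 * (?m * 2 ^ (2 * \<eta>))) * of_int ?den :: rat)"
    by (simp only: of_int_abs of_int_mult of_int_of_nat_eq)
  moreover have "0 < (of_int ?den :: rat)" using den by (simp only: of_int_0_less_iff)
  ultimately show ?thesis
    by (simp only: clique_graph_simps abs_divide abs_of_pos pos_divide_le_eq)
qed

lemma program_computes_reduction:
  obtains s T S where "run w program_code (cvp_input n k I) s T S"
    "clique_output s (num_verts n k) (clique_graph n k I)"
    "T \<le> 4000000 * (dim_row (basis I) * \<eta>\<^sup>2 * (num_verts n k)\<^sup>2 + (rat_bits (distance I))\<^sup>2)"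
    "S \<le> 4000000 * (dim_row (basis I) * \<eta>\<^sup>2 * (num_verts n k)\<^sup>2 + (rat_bits (distance I))\<^sup>2)"
proof -
  let ?m = "dim_row (basis I)" and ?q = "block_size n k" and ?N = "num_verts n k"
  let ?s0 = "cvp_input n k I" and ?h = "parameters n k I"
  obtain p d where pd: "quotient_of (distance I) = (p, d)" by (cases "quotient_of (distance I)")
  have dist: "distance I = of_int p / of_int d" and d: "0 < d"
    using quotient_of_div[OF pd] quotient_of_denom_pos[OF pd] by auto
  have h: "?h 0 = int n" "?h 1 = int k" "?h 2 = int ?m" "?h 3 = p" "?h 4 = d"
    "\<And>i. 5 \<le> i \<Longrightarrow> ?h i = 0"
    by (simp_all add: parameters_def cvp_input_def Let_def pd)
  have s0: "?s0 0 = ?h" "?s0 1 = basis_array I" "?s0 2 = target_array I" "\<And>A. 3 \<le> A \<Longrightarrow> ?s0 A = (\<lambda>_. 0)"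
    by (auto simp: parameters_def cvp_input_def Let_def pd basis_array_def target_array_def dims)
  have R: "bits (?h 3) \<le> rat_bits (distance I)" "bits (?h 4) \<le> rat_bits (distance I)"
    by (simp_all add: h rat_bits_def pd)
  have supp: "basis_array I a = 0" if "?N * ?m \<le> a" for a
  proof -
    have "?m * n \<le> ?m * ?N" by (intro mult_le_mono2 n_le_N)
    also have "\<dots> \<le> a" using that by (simp add: mult.commute)
    finally show ?thesis by (simp add: basis_array_def Let_def dims)
  qed
  have supp': "target_array I a = 0" if "?m \<le> a" for a
    using that by (simp add: target_array_def)
  obtain s T S where run: "run w program_code ?s0 s T S"
    and TS: "T \<le> 4000000 * (?m * \<eta>\<^sup>2 * ?N\<^sup>2 + (rat_bits (distance I))\<^sup>2)"
    "S \<le> 4000000 * (?m * \<eta>\<^sup>2 * ?N\<^sup>2 + (rat_bits (distance I))\<^sup>2)"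
    and s: "s 3 = fill (?N * ?N) adjacency" "s 4 = fill (?N * ?N) numerators"
    "s 5 = fill (?N * ?N) (\<lambda>_. denominator)"
    "s 6 0 = ?h 3 * ?h 3 - ?h 4 * ?h 4 * norm_sum" "s 6 1 = ?h 4 * ?h 4 * (int ?q * int ?q)"
    "s 6 2 = int ?N"
    using program_run[OF s0 h(1-3,6) R supp supp'] by blast
  have "clique_output s ?N (clique_graph n k I)"
    unfolding clique_output_def
  proof (intro conjI allI impI)
    fix u v assume uv: "u < ?N" "v < ?N"
    have "u * ?N + v < Suc u * ?N" using uv by simp
    also have "\<dots> \<le> ?N * ?N" using uv by (intro mult_le_mono1) simp
    finally have "u * ?N + v < ?N * ?N" .
    then have cells: "s 3 (u * ?N + v) = of_bool (u div 2 ^ ?q \<noteq> v div 2 ^ ?q)"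
      "s 4 (u * ?N + v) = edge_num k ?q ?m (basis_array I) (target_array I) u v"
      "s 5 (u * ?N + v) = denominator"
      using uv by (simp_all add: s fill_def)
    show "s 3 (u * ?N + v) = (if {u, v} \<in> edges (clique_graph n k I) then 1 else 0)"
      using uv by (simp add: cells doubleton_in_edges)
    show "0 < s 5 (u * ?N + v)"
      using q_pos k2 by (simp add: cells)
    have "edge_num k ?q ?m (basis_array I) (target_array I) (Min {u, v}) (Max {u, v})
        = edge_num k ?q ?m (basis_array I) (target_array I) u v"
      using edge_num_commute by (cases "u \<le> v") (auto simp: max_def min_def)
    then show "weight (clique_graph n k I) {u, v}
        = of_int (s 4 (u * ?N + v)) / of_int (s 5 (u * ?N + v))"
      by (simp only: cells clique_graph_simps)
  next
    show "0 < s 6 1" unfolding s h using d q_pos by simp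
    have scale: "((of_int p / of_int d)\<^sup>2 - of_int y) / of_int x
        = (of_int (p * p - d * d * y) / of_int (d * d * x) :: rat)" if "x \<noteq> 0" for x y :: int
      using d that by (simp add: field_simps power2_eq_square)
    show "threshold (clique_graph n k I) = of_int (s 6 0) / of_int (s 6 1)"
      unfolding clique_graph_simps dist s h by (rule scale) (use q_pos in simp)
  qed (simp_all add: s)
  then show ?thesis using that run TS by blast
qed

end

theorem theorem3p2:
  shows "\<exists>(P :: com) (C :: nat). \<forall>(n :: nat) (k :: nat). 1 \<le> n \<longrightarrow> 2 \<le> k \<longrightarrow>
    (\<exists>f :: cvp_instance \<Rightarrow> nat clique_instance.
       karp_reduction (cvp01 n) (min_weight_clique k (num_verts n k)) f \<and>
       (\<forall>(I :: cvp_instance) (w :: nat).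
          valid_cvp n I \<longrightarrow> dim_row (basis I) + num_verts n k \<le> 2 ^ w \<longrightarrow>
          (\<exists>(s :: mem) (T :: nat) (S :: nat).
             run w P (cvp_input n k I) s T S \<and> clique_output s (num_verts n k) (f I) \<and>
             (\<forall>\<eta> :: nat. 1 \<le> \<eta> \<longrightarrow> coords_bounded \<eta> I \<longrightarrow>
                T \<le> C * (dim_row (basis I) * \<eta>\<^sup>2 * (num_verts n k)\<^sup>2 + (rat_bits (distance I))\<^sup>2) \<and>
                S \<le> C * (dim_row (basis I) * \<eta>\<^sup>2 * (num_verts n k)\<^sup>2 + (rat_bits (distance I))\<^sup>2) \<and>
                (\<forall>e \<in> edges (f I).
                   \<bar>weight (f I) e\<bar> \<le> of_nat (C * (dim_row (basis I) * 2 ^ (2 * \<eta>))))))))"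
proof -
  have main: "\<exists>s T S. run w program_code (cvp_input n k I) s T S
      \<and> clique_output s (num_verts n k) (clique_graph n k I)
      \<and> (\<forall>\<eta>. 1 \<le> \<eta> \<longrightarrow> coords_bounded \<eta> I \<longrightarrow>
        T \<le> 4000000 * (dim_row (basis I) * \<eta>\<^sup>2 * (num_verts n k)\<^sup>2 + (rat_bits (distance I))\<^sup>2)
        \<and> S \<le> 4000000 * (dim_row (basis I) * \<eta>\<^sup>2 * (num_verts n k)\<^sup>2 + (rat_bits (distance I))\<^sup>2)
        \<and> (\<forall>e\<in>edges (clique_graph n k I). \<bar>weight (clique_graph n k I) e\<bar>
            \<le> of_nat (4000000 * (dim_row (basis I) * 2 ^ (2 * \<eta>)))))"
    if n: "1 \<le> n" and k: "2 \<le> k" and I: "valid_cvp n I"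
      and w: "dim_row (basis I) + num_verts n k \<le> 2 ^ w" for n k I w
  proof -
    \<comment> \<open>This value only yields the run and its output; the bounds are proved for each
      \<eta> separately.\<close>
    obtain \<eta>\<^sub>0 where "1 \<le> \<eta>\<^sub>0" "coords_bounded \<eta>\<^sub>0 I" using ex_coords_bounded by blast
    then interpret cvp_reduction n k w \<eta>\<^sub>0 I using n k I w by unfold_locales
    obtain s T S where run: "run w program_code (cvp_input n k I) s T S"
      and out: "clique_output s (num_verts n k) (clique_graph n k I)"
      by (rule program_computes_reduction)
    have "T \<le> 4000000 * (dim_row (basis I) * \<eta>\<^sup>2 * (num_verts n k)\<^sup>2 + (rat_bits (distance I))\<^sup>2)
        \<and> S \<le> 4000000 * (dim_row (basis I) * \<eta>\<^sup>2 * (num_verts n k)\<^sup>2 + (rat_bits (distance I))\<^sup>2)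
        \<and> (\<forall>e\<in>edges (clique_graph n k I). \<bar>weight (clique_graph n k I) e\<bar>
            \<le> of_nat (4000000 * (dim_row (basis I) * 2 ^ (2 * \<eta>))))"
      if "1 \<le> \<eta>" "coords_bounded \<eta> I" for \<eta>
    proof -
      \<comment> \<open>The analysis for this \<eta> produces a run of its own, which determinism
        identifies with the one fixed above.\<close>
      interpret other: cvp_reduction n k w \<eta> I using n k I w that by unfold_locales
      obtain s' T' S' where "run w program_code (cvp_input n k I) s' T' S'"
        "T' \<le> 4000000 * (dim_row (basis I) * \<eta>\<^sup>2 * (num_verts n k)\<^sup>2 + (rat_bits (distance I))\<^sup>2)"
        "S' \<le> 4000000 * (dim_row (basis I) * \<eta>\<^sup>2 * (num_verts n k)\<^sup>2 + (rat_bits (distance I))\<^sup>2)"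
        by (rule other.program_computes_reduction)
      moreover have "(of_nat (8 * (dim_row (basis I) * 2 ^ (2 * \<eta>))) :: rat)
          \<le> of_nat (4000000 * (dim_row (basis I) * 2 ^ (2 * \<eta>)))"
        unfolding of_nat_le_iff by (rule mult_le_mono1) simp
      ultimately show ?thesis
        using run_deterministic[OF run] other.weight_bound order_trans by blast
    qed
    with run out show ?thesis by blast
  qed
  show ?thesis
    by (intro exI[of _ program_code] exI[of _ 4000000] allI impI)
      (use main karp_reduction_clique_graph in blast)
qed

end
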